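(* Let $k\ge 3$ be an odd integer and put $N=k$. Expand the function $$F_o^k(x)=2^{\frac{k-3}{2}}\,\frac{1}{\tilde L^{k,k}_{\frac{k-3}{2}}(e^x)}\frac{d}{dx}\,\frac{1}{\tilde L^{k,k}_{\frac{k-5}{2}}(e^x)}\cdots\frac{d}{dx}\,\frac{1}{\tilde L^{k,k}_{1}(e^x)}\,\frac{d}{dx}\,\frac{\tau_k(x)}{\tilde L^{k,k}_0(e^x)}$$ in the form $$F_o^k(x)=\sum_{d=1}^{\infty}c^k_{2d-1}\,e^{(d-\frac12)x}.$$ Then for every positive integer $d$, $$c^k_{2d-1}=w^{k,k}_{disk}(\mathcal{O}_{h^{\frac{k-3}{2}}})_{2d-1}.$$
   Context: All functions of $x$ are regarded as (formal) series in $e^{x/2}$ with coefficients polynomial in $x$, expanded around $x=-\infty$. **The function $\tau_k$.** $\displaystyle \tau_k(x):=\sum_{d=1}^\infty 2\,\frac{(k(2d-1))!!}{((2d-1)!!)^k}\,e^{\frac{2d-1}{2}x}$, where $n!!=n(n-2)\cdots 3\cdot 1$ for odd $n$. **The series $\tilde L^{k,k}_n$.** Let $$w(x,y):=\sum_{d=0}^{\infty}\frac{\prod_{j=1}^{kd}(j+ky)}{\prod_{j=1}^{d}(j+y)^k}\,e^{(d+y)x},\qquad w_j(x):=\frac{1}{j!}\frac{\partial^j w}{\partial y^j}(x,0)\quad(0\le j\le k-2).$$ Define inductively $\tilde L^{k,k}_0(e^x):=w_0(x)$ and, for $j\ge 1$, $$\tilde L^{k,k}_j(e^x):=\frac{d}{dx}\left(\frac{1}{\tilde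 L^{k,k}_{j-1}(e^x)}\frac{d}{dx}\left(\frac{1}{\tilde L^{k,k}_{j-2}(e^x)}\frac{d}{dx}\left(\cdots\frac{d}{dx}\left(\frac{1}{\tilde L^{k,k}_1(e^x)}\frac{d}{dx}\frac{w_j(x)}{\tilde L^{k,k}_0(e^x)}\right)\cdots\right)\right)\right).$$ Each $\tilde L^{k,k}_j(e^x)$ is a power series in $e^x$ with constant term $1$: $\tilde L^{k,k}_j(e^x)=1+\sum_{d\ge1}\tilde L^{k,k,d}_j e^{dx}$. In the definition of $F_o^k$ each $\frac{d}{dx}$ acts on everything to its right, and there are $\frac{k-3}{2}$ derivatives in total (for $k=3$, $F_o^3=\tau_3/\tilde L_0^{3,3}$). **Open virtual structure constants.** For positive integers $N$, $d$ and odd $k$, put $$f^{N,k}_{2d-1}(z):=\frac{2}{2d-1}\cdot\frac{\prod_{j=0}^{kd-\frac{k+1}{2}}\left(\frac{j(-z)+(k(2d-1)-j)z}{2d-1}\right)}{\prod_{j=1}^{d-1}\left(\frac{j(-z)+(2d-1-j)z}{2d-1}\right)^N},\qquad e^k(z,w):=\prod_{j=0}^k\bigl(jz+(k-j)w\bigr).$$ For an integer $a\geq 0$ define $$w^{N,k}_{disk}(\mathcal{O}_{h^a})_{2d-1}:=\sum_{j=0}^{d-1}\frac{1}{(2\pi\sqrt{-1})^{j+1}}\oint_{C_j}\frac{dz_j}{(z_j)^N}\cdots\oint_{C_0}\frac{dz_0}{(z_0)^N}\;f^{N,k}_{2d-2j-1}(z_0)\prod_{i=1}^{j}e^k(z_{i-1},z_i)\cdot\frac{1}{kz_0\left(\frac{2}{2d-2j-1}z_0+z_0-z_1\right)}\prod_{i=1}^{j-1}\frac{1}{kz_i(2z_i-z_{i-1}-z_{i+1})}\;(z_j)^a.$$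 For $j=0$ the factor $\frac{1}{kz_0(\frac{2}{2d-2j-1}z_0+z_0-z_1)}$ and the products are absent, so the $j=0$ term is $\frac{1}{2\pi\sqrt{-1}}\oint_{C_0}\frac{dz_0}{z_0^N}f^{N,k}_{2d-1}(z_0)z_0^a$. Here $\frac{1}{2\pi\sqrt{-1}}\oint_{C_i}dz_i$ means taking the sum of residues at $z_i=0$ and at $z_i=\frac{z_{i-1}+z_{i+1}}{2}$ if $1\le i\le j-1$, and the residue at $z_i=0$ if $i=0$ or $i=j$. The variables are integrated in ascending order of the subscript ($z_0$ first, $z_j$ last); thus when $z_i$ is integrated, the second kind of residue is taken at the pole in $z_i$ coming from the factor $2z_i-z_{i-1}-z_{i+1}$ after $z_0,\dots,z_{i-1}$ have been eliminated by the preceding residues. *)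

theory Defs
  imports "HOL-Complex_Analysis.Complex_Analysis" "HOL-Computational_Algebra.Computational_Algebra"
begin

section \<open>Series in exp (x/2) with coefficients polynomial in x\<close>

text \<open>
  A formal series \<open>\<Sum>n. p\<^sub>n(x) exp (n x/2)\<close> is represented by the element \<open>Abs_fps p\<close> of
  \<open>complex poly fps\<close>: the variable of the \<open>fps\<close> stands for \<open>exp (x/2)\<close>, the variable of the
  polynomials for \<open>x\<close>.
\<close>

type_synonym exp_series = "complex poly fps"

text \<open>From \<open>d/dx (p(x) exp (n x/2)) = (p'(x) + n/2 p(x)) exp (n x/2)\<close>.\<close>

definition ddx :: "exp_series \<Rightarrow> exp_series" where
  "ddx f = Abs_fps (\<lambda>n. pderiv (fps_nth f n) + smult (of_nat n / 2) (fps_nth f n))"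

text \<open>
  The class-based \<open>inverse\<close> of \<open>fps\<close> is not available over \<open>complex poly\<close>. The following is the
  reciprocal of a series whose constant term is \<open>1\<close>; only such series occur as denominators.
\<close>

definition recip :: "exp_series \<Rightarrow> exp_series" where
  "recip f = fps_right_inverse f 1"

lemma recip_right_inverse: "fps_nth f 0 = 1 \<Longrightarrow> f * recip f = 1"
  unfolding recip_def by (rule fps_right_inverse) simp

text \<open>The series \<open>\<Sum>d\<ge>1. c\<^sub>d exp ((2d - 1) x/2)\<close> with constants \<open>c\<^sub>d\<close>.\<close>

definition odd_exp_series :: "(nat \<Rightarrow> complex) \<Rightarrow> exp_series" where
  "odd_exp_series c = Abs_fps (\<lambda>n. if odd n then [:c ((n + 1) div 2):] else 0)"


section \<open>The functions \<open>\<tau>\<close>, \<open>w\<close> and \<open>L\<close>\<close>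

text \<open>\<open>n!!\<close>, used for odd \<open>n\<close> only.\<close>

definition odd_double_fact :: "nat \<Rightarrow> nat" where
  "odd_double_fact n = (\<Prod>i | odd i \<and> i \<le> n. i)"

definition tau :: "nat \<Rightarrow> exp_series" where
  "tau k = odd_exp_series (\<lambda>d.
     2 * of_nat (odd_double_fact (k * (2 * d - 1))) / of_nat (odd_double_fact (2 * d - 1)) ^ k)"

text \<open>
  The rational function of \<open>y\<close> in the \<open>d\<close>-th term of \<open>w(x,y)\<close>, expanded at \<open>y = 0\<close>;
  here \<open>fps_X\<close> is \<open>y\<close>.
\<close>

definition w_ratio :: "nat \<Rightarrow> nat \<Rightarrow> complex fps" where
  "w_ratio k d = (\<Prod>j=1..k*d. of_nat j + of_nat k * fps_X) / (\<Prod>j=1..d. (of_nat j + fps_X) ^ k)"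

text \<open>\<open>exp (y x)\<close> as a power series in \<open>y\<close> over the polynomials in \<open>x\<close>.\<close>

definition exp_yx :: "complex poly fps" where
  "exp_yx = Abs_fps (\<lambda>i. monom (1 / fact i) i)"

text \<open>
  \<open>w(x,y)\<close>: the outer variable is \<open>exp (x/2)\<close>, so that \<open>exp (d x)\<close> sits in degree \<open>2d\<close>, and the inner
  one is \<open>y\<close>.
\<close>

definition w_series :: "nat \<Rightarrow> complex poly fps fps" where
  "w_series k = Abs_fps (\<lambda>n. if even n
     then Abs_fps (\<lambda>i. [:fps_nth (w_ratio k (n div 2)) i:]) * exp_yx else 0)"

text \<open>\<open>w\<^sub>j(x)\<close>, i.e. \<open>1/j! (\<partial>/\<partial>y)\<^sup>j\<close> of \<open>w(x,y)\<close> at \<open>y = 0\<close>.\<close>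

definition w_deriv :: "nat \<Rightarrow> nat \<Rightarrow> exp_series" where
  "w_deriv k j = Abs_fps (\<lambda>n. smult (1 / fact j) (fps_nth ((fps_deriv ^^ j) (fps_nth (w_series k) n)) 0))"

text \<open>
  \<open>nested L g m\<close> is \<open>1/L\<^sub>m d/dx (1/L\<^sub>m\<^sub>-\<^sub>1 d/dx (\<dots> 1/L\<^sub>1 d/dx (g/L\<^sub>0)))\<close>, with \<open>m\<close> derivatives.
\<close>

primrec nested :: "(nat \<Rightarrow> exp_series) \<Rightarrow> exp_series \<Rightarrow> nat \<Rightarrow> exp_series" where
  "nested L g 0 = recip (L 0) * g"
| "nested L g (Suc m) = recip (L (Suc m)) * ddx (nested L g m)"

lemma nested_cong [fundef_cong]:
  assumes "g = g'" "m = m'" "\<And>i. i \<le> m' \<Longrightarrow> L i = L' i"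
  shows "nested L g m = nested L' g' m'"
  unfolding assms(1,2) using assms(3) by (induction m') auto

fun Lt :: "nat \<Rightarrow> nat \<Rightarrow> exp_series" where
  "Lt k 0 = w_deriv k 0"
| "Lt k (Suc j) = ddx (nested (\<lambda>i. Lt k i) (w_deriv k (Suc j)) j)"

definition F_o :: "nat \<Rightarrow> exp_series" where
  "F_o k = 2 ^ ((k - 3) div 2) * nested (Lt k) (tau k) ((k - 3) div 2)"


section \<open>Open virtual structure constants\<close>

text \<open>\<open>f_disk N k d\<close> is the function with index \<open>2d - 1\<close>.\<close>

definition f_disk :: "nat \<Rightarrow> nat \<Rightarrow> nat \<Rightarrow> complex \<Rightarrow> complex" where
  "f_disk N k d z = 2 / of_nat (2 * d - 1) *
     ((\<Prod>j=0..k * d - (k + 1) div 2.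
         (of_nat j * (- z) + (of_nat (k * (2 * d - 1)) - of_nat j) * z) / of_nat (2 * d - 1)) /
      (\<Prod>j=1..d - 1.
         (of_nat j * (- z) + (of_nat (2 * d - 1) - of_nat j) * z) / of_nat (2 * d - 1)) ^ N)"

definition e_edge :: "nat \<Rightarrow> complex \<Rightarrow> complex \<Rightarrow> complex" where
  "e_edge k z z' = (\<Prod>j=0..k. of_nat j * z + (of_nat k - of_nat j) * z')"

definition disk_integrand ::
    "nat \<Rightarrow> nat \<Rightarrow> nat \<Rightarrow> nat \<Rightarrow> nat \<Rightarrow> (nat \<Rightarrow> complex) \<Rightarrow> complex" where
  "disk_integrand N k a d j z =
     (\<Prod>i=0..j. 1 / z i ^ N) * f_disk N k (d - j) (z 0) *
     (\<Prod>i=1..j. e_edge k (z (i - 1)) (z i)) *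
     (if j = 0 then 1
      else 1 / (of_nat k * z 0 * (2 / of_nat (2 * (d - j) - 1) * z 0 + z 0 - z 1))) *
     (\<Prod>i=1..j - 1. 1 / (of_nat k * z i * (2 * z i - z (i - 1) - z (i + 1)))) *
     z j ^ a"

text \<open>
  Residue in the variable \<open>z\<^sub>i\<close>, the other variables being held fixed, at the point \<open>p\<close>,
  which may depend on the other variables. The result does not depend on \<open>z\<^sub>i\<close>.
\<close>

definition residue_var ::
    "nat \<Rightarrow> ((nat \<Rightarrow> complex) \<Rightarrow> complex) \<Rightarrow> ((nat \<Rightarrow> complex) \<Rightarrow> complex) \<Rightarrow> (nat \<Rightarrow> complex) \<Rightarrow> complex"
  where "residue_var i p G = (\<lambda>z. residue (\<lambda>t. G (z(i := t))) (p z))"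

text \<open>
  \<open>iter_residue n i r G\<close> integrates \<open>z\<^sub>i, \<dots>, z\<^sub>i\<^sub>+\<^sub>n\<close> in this order, all but the last one over both
  kinds of poles. The function \<open>G\<close> is what remains after the elimination of \<open>z\<^sub>0, \<dots>, z\<^sub>i\<^sub>-\<^sub>1\<close>, the
  residue in \<open>z\<^sub>i\<^sub>-\<^sub>1\<close> having been taken at \<open>z\<^sub>i\<^sub>-\<^sub>1 = r z\<^sub>i\<close>. The pole \<open>2 z\<^sub>i = z\<^sub>i\<^sub>-\<^sub>1 + z\<^sub>i\<^sub>+\<^sub>1\<close> is
  then at \<open>z\<^sub>i = z\<^sub>i\<^sub>+\<^sub>1 / (2 - r)\<close>; a residue at \<open>0\<close> corresponds to \<open>r = 0\<close>.
\<close>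

primrec iter_residue ::
    "nat \<Rightarrow> nat \<Rightarrow> complex \<Rightarrow> ((nat \<Rightarrow> complex) \<Rightarrow> complex) \<Rightarrow> (nat \<Rightarrow> complex) \<Rightarrow> complex" where
  "iter_residue 0 i r G = residue_var i (\<lambda>_. 0) G"
| "iter_residue (Suc n) i r G = (\<lambda>z.
     iter_residue n (Suc i) 0 (residue_var i (\<lambda>_. 0) G) z +
     iter_residue n (Suc i) (1 / (2 - r)) (residue_var i (\<lambda>z. z (Suc i) / (2 - r)) G) z)"

text \<open>
  In \<open>z\<^sub>0\<close> only the residue at \<open>0\<close> is taken. Once all variables are integrated nothing depends on
  them any more, so the final argument \<open>\<lambda>_. 0\<close> is arbitrary.
\<close>

definition disk_term :: "nat \<Rightarrow> nat \<Rightarrow> nat \<Rightarrow> nat \<Rightarrow> nat \<Rightarrow> complex" where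
  "disk_term N k a d j =
     (let G = residue_var 0 (\<lambda>_. 0) (disk_integrand N k a d j)
      in if j = 0 then G (\<lambda>_. 0) else iter_residue (j - 1) 1 0 G (\<lambda>_. 0))"

text \<open>The open virtual structure constant with index \<open>2d - 1\<close> and insertion \<open>h\<^sup>a\<close>.\<close>

definition w_disk :: "nat \<Rightarrow> nat \<Rightarrow> nat \<Rightarrow> nat \<Rightarrow> complex" where
  "w_disk N k a d = (\<Sum>j=0..d - 1. disk_term N k a d j)"

end

theory Submission
  imports Defs
begin

text \<open>
  Put \<open>k = 2 m + 1\<close> and \<open>q = exp x\<close>. Let \<open>N\<^sub>p(y) = exp (-y x) L\<^sub>p\<^sup>-\<^sup>1 d/dx \<dots> L\<^sub>1\<^sup>-\<^sup>1 d/dx (w(x,y) / L\<^sub>0)\<close>, whose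
  \<open>q\<close>-coefficients are rational functions of \<open>y\<close>. By the definition of the \<open>L\<^sub>j\<close>, \<open>N\<^sub>p(y) = y\<^sup>p + O(y\<^sup>p\<^sup>+\<^sup>1)\<close>, so
  \<open>S(y) = N\<^sub>m(y) / y\<^sup>m\<close> is regular at \<open>0\<close> with \<open>S(0) = 1\<close>. Since \<open>\<tau>\<close> is a multiple of \<open>w(x,1/2)\<close>, \<open>F_o\<close> is a
  multiple of \<open>exp (x/2) N\<^sub>m\<^sub>-\<^sub>1(1/2)\<close>.

  The palindromic operator \<open>L\<^sub>0\<^sup>-\<^sup>1 d/dx \<dots> d/dx L\<^sub>m\<^sup>-\<^sup>1 d/dx \<dots> d/dx L\<^sub>0\<^sup>-\<^sup>1\<close> is the hypergeometric operator: the
  difference of the two symbols is, in each degree \<open>N > 0\<close> in \<open>q\<close>, a polynomial in \<open>y\<close> of degree at most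
  \<open>2 m\<close>, invariant under \<open>y \<mapsto> -y - N\<close> by self-adjointness, and it vanishes to order \<open>m + 1\<close> at \<open>y = 0\<close>
  because the operator annihilates \<open>w\<^sub>0, \<dots>, w\<^sub>m\<close>. Integration by parts then evaluates the constant term
  of \<open>F_o' \<cdot> exp (-n x) S(-n)\<close> for half-integers \<open>n\<close>; it is \<open>n\<close> times the value of \<open>f_disk\<close> at \<open>1\<close>.

  On the residue side everything is homogeneous, and in the coordinates \<open>t = z\<^sub>i / (z\<^sub>i - z\<^sub>i\<^sub>+\<^sub>1)\<close> each elimination
  is a residue operator on functions of one variable. The functions
  \<open>(\<Sum>n'. n' F\<^sub>n\<^sub>' S\<^sub>n\<^sub>-\<^sub>n\<^sub>'(y)) / (n + y)\<close>, with \<open>F\<^sub>n\<^sub>'\<close> the coefficients of \<open>F_o\<close>, satisfy the same recursion: it is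
  their partial fraction expansion, where the pole at \<open>-n\<close> is given by the constant term above and the poles
  at negative integers by the relation between \<open>w(x,y-1)\<close> and \<open>w(x,y)\<close>. The values at \<open>y = 0\<close> are the claim.
\<close>

section \<open>Residues of meromorphic functions\<close>

text \<open>A suitable power of \<open>t - p\<close>, read off from the subdegree, removes the
  negative terms of the Laurent expansion.\<close>

lemma meromorphic_at_factor:
  assumes "f meromorphic_on {p}"
  obtains g N where "g analytic_on {p}" "\<forall>\<^sub>F t in at p. f t = g t / (t - p) ^ N"
proof -
  obtain F where F: "(\<lambda>w. f (p + w)) has_laurent_expansion F"
    using assms by (auto simp: meromorphic_on_def)
  define N where "N = nat (- fls_subdegree F)"
  define H where "H = F * fls_X ^ N"
  have H: "(\<lambda>w. f (p + w) * w ^ N) has_laurent_expansion H"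
    unfolding H_def by (intro laurent_expansion_intros F)
  have sub: "fls_subdegree H \<ge> 0"
    by (cases "F = 0") (auto simp: H_def N_def)
  have "(\<lambda>t. eval_fls H (t - p)) analytic_on {p}"
    by (intro analytic_intros) (use H sub in \<open>auto simp: has_laurent_expansion_def zero_ereal_def\<close>)
  moreover have "\<forall>\<^sub>F t in at p. f t = eval_fls H (t - p) / (t - p) ^ N"
  proof -
    have "\<forall>\<^sub>F t in at p. eval_fls H (t - p) = f t * (t - p) ^ N"
      using H by (simp add: has_laurent_expansion_def at_to_0' eventually_filtermap add.commute)
    moreover have "\<forall>\<^sub>F t in at p. t \<noteq> p"
      by (simp add: eventually_at_filter)
    ultimately show ?thesis by eventually_elim auto
  qed
  ultimately show ?thesis using that by blast
qed

lemma residue_analytic: "f analytic_on {p} \<Longrightarrow> residue f p = 0"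
  unfolding analytic_on_def using residue_holo[of "ball p _" p f] by fastforce

text \<open>The formal derivative of a Laurent series has no term of degree
  \<open>-1\<close>.\<close>

lemma residue_meromorphic_deriv:
  assumes "f meromorphic_on {p}"
  shows "residue (deriv f) p = 0"
proof -
  obtain F where F: "(\<lambda>w. f (p + w)) has_laurent_expansion F"
    using assms by (auto simp: meromorphic_on_def)
  have "(\<lambda>w. deriv f (p + w)) has_laurent_expansion fls_deriv F"
  proof -
    have "deriv (\<lambda>w. f (p + w)) = (\<lambda>w. deriv f (p + w))"
      by (simp add: deriv_shift_0' add_ac o_def fun_eq_iff)
    then show ?thesis using has_laurent_expansion_deriv[OF F] by simp
  qed
  then show ?thesis
    using has_laurent_expansion_residue fls_residue_deriv by metis
qed

lemma residue_meromorphic_add: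
  assumes "f meromorphic_on {p}" "g meromorphic_on {p}"
  shows "residue (\<lambda>t. f t + g t) p = residue f p + residue g p"
proof -
  obtain F G where FG: "(\<lambda>w. f (p + w)) has_laurent_expansion F" "(\<lambda>w. g (p + w)) has_laurent_expansion G"
    using assms by (auto simp: meromorphic_on_def)
  show ?thesis
    using has_laurent_expansion_residue[OF FG(1)] has_laurent_expansion_residue[OF FG(2)]
      has_laurent_expansion_residue[of "\<lambda>t. f t + g t", OF has_laurent_expansion_add[OF FG]]
    by (simp add: fls_residue_add)
qed

lemma residue_meromorphic_cmult:
  assumes "f meromorphic_on {p}"
  shows "residue (\<lambda>t. c * f t) p = c * residue f p"
proof -
  obtain F where F: "(\<lambda>w. f (p + w)) has_laurent_expansion F"
    using assms by (auto simp: meromorphic_on_def)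
  show ?thesis
    using has_laurent_expansion_residue[OF F]
      has_laurent_expansion_residue[of "\<lambda>t. c * f t", OF has_laurent_expansion_cmult_left[OF F]]
    by (simp add: fls_residue_fls_const_times)
qed

lemma residue_meromorphic_sum:
  assumes "finite A" "\<And>i. i \<in> A \<Longrightarrow> f i meromorphic_on {p}"
  shows "residue (\<lambda>t. \<Sum>i\<in>A. f i t) p = (\<Sum>i\<in>A. residue (f i) p)"
  using assms
proof (induction A rule: finite_induct)
  case empty
  then show ?case by (simp add: residue_const)
next
  case (insert x A)
  then show ?case
    by (simp add: residue_meromorphic_add meromorphic_intros)
qed

section \<open>Change of variable in residues\<close>

lemma eventually_analytic_at:
  assumes "f analytic_on {z}"
  shows "\<forall>\<^sub>F w in nhds z. f analytic_on {w}"
proof -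
  obtain S where "open S" "z \<in> S" "f holomorphic_on S"
    using assms by (auto simp: analytic_at)
  then show ?thesis
    unfolding eventually_nhds by (auto simp: analytic_at)
qed

lemma has_field_derivative_over_power:
  fixes G P :: "'a :: real_normed_field \<Rightarrow> 'a"
  assumes "(G has_field_derivative D) (at x)" "(P has_field_derivative D') (at x)" "P x \<noteq> 0"
  shows "((\<lambda>x. G x / P x ^ n) has_field_derivative
    D / P x ^ n + (- of_nat n) * (G x / P x ^ Suc n * D')) (at x)"
proof (cases n)
  case 0
  then show ?thesis using assms(1) by simp
next
  case (Suc l)
  have "((\<lambda>x. G x * inverse (P x) ^ n) has_field_derivative
      D * inverse (P x) ^ n + (of_nat n * (- (inverse (P x) * D' * inverse (P x)) * inverse (P x) ^ (n - Suc 0))) * G x) (at x)"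
    by (rule DERIV_mult[OF assms(1) DERIV_power[OF DERIV_inverse'[OF assms(2,3)]]])
  moreover have "(\<lambda>x. G x * inverse (P x) ^ n) = (\<lambda>x. G x / P x ^ n)"
    by (simp add: fun_eq_iff power_inverse divide_inverse)
  moreover have "D * inverse (P x) ^ n + (of_nat n * (- (inverse (P x) * D' * inverse (P x)) * inverse (P x) ^ (n - Suc 0))) * G x
      = D / P x ^ n + (- of_nat n) * (G x / P x ^ Suc n * D')"
    using assms(3) Suc by (simp add: field_simps)
  ultimately show ?thesis by simp
qed

lemma filterlim_at_deriv_nonzero:
  assumes "(\<psi> has_field_derivative D) (at z)" "D \<noteq> 0"
  shows "filterlim \<psi> (at (\<psi> z)) (at (z :: 'a :: real_normed_field))"
proof -
  have "((\<lambda>w. (\<psi> w - \<psi> z) / (w - z)) \<longlongrightarrow> D) (at z)"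
    using assms(1) by (simp add: has_field_derivative_iff)
  then have "\<forall>\<^sub>F w in at z. (\<psi> w - \<psi> z) / (w - z) \<noteq> 0"
    using assms(2) tendsto_imp_eventually_ne by blast
  then have "\<forall>\<^sub>F w in at z. \<psi> w \<noteq> \<psi> z"
    by eventually_elim auto
  moreover have "(\<psi> \<longlongrightarrow> \<psi> z) (at z)"
    using DERIV_isCont[OF assms(1)] by (simp add: isCont_def)
  ultimately show ?thesis by (simp add: filterlim_at)
qed

text \<open>Induction on the pole order. A derivative has residue 0, so on both sides a pole of
  order \<open>n + 1\<close> with numerator \<open>g\<close> is traded for one of order
  \<open>n\<close> with numerator \<open>deriv g\<close>; simple poles are computed
  directly.\<close>

lemma residue_substitution_aux:
  assumes "g analytic_on {\<psi> z}" and \<psi>: "\<psi> analytic_on {z}" "deriv \<psi> z \<noteq> 0"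
  shows "residue (\<lambda>w. g (\<psi> w) / (\<psi> w - \<psi> z) ^ N * deriv \<psi> w) z = residue (\<lambda>t. g t / (t - \<psi> z) ^ N) (\<psi> z)"
  using assms(1)
proof (induction N arbitrary: g)
  case 0
  have "(\<lambda>w. g (\<psi> w)) analytic_on {z}"
    using analytic_on_compose[OF \<psi>(1), of g] 0 by (simp add: o_def)
  then have "(\<lambda>w. g (\<psi> w) * deriv \<psi> w) analytic_on {z}"
    by (intro analytic_intros \<psi>)
  then show ?case using 0 by (simp add: residue_analytic)
next
  case (Suc n)
  let ?t = "\<psi> z"
  have g\<psi>: "(\<lambda>w. g (\<psi> w)) analytic_on {z}"
    using analytic_on_compose[OF \<psi>(1), of g] Suc.prems by (simp add: o_def)
  have \<psi>': "(\<psi> has_field_derivative deriv \<psi> z) (at z)"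
    using analytic_derivI[OF \<psi>(1)] .
  show ?case
  proof (cases n)
    case 0
    have *: "residue (\<lambda>w. h (\<psi> w) * deriv \<psi> w / (\<psi> w - ?t)) z = h ?t"
      if h: "h analytic_on {?t}" "h ?t \<noteq> 0" for h
    proof -
      have "(\<lambda>w. h (\<psi> w)) analytic_on {z}"
        using analytic_on_compose[OF \<psi>(1), of h] h by (simp add: o_def)
      then have "(\<lambda>w. h (\<psi> w) * deriv \<psi> w) analytic_on {z}"
        by (intro analytic_intros \<psi>)
      then obtain e2 where e2: "e2 > 0" "(\<lambda>w. h (\<psi> w) * deriv \<psi> w) holomorphic_on ball z e2"
        by (auto simp: analytic_on_def)
      obtain e3 where e3: "e3 > 0" "\<psi> holomorphic_on ball z e3"
        using \<psi> by (auto simp: analytic_on_def)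
      define e where "e = min e2 e3"
      have e: "e > 0" "(\<lambda>w. h (\<psi> w) * deriv \<psi> w) holomorphic_on ball z e" "\<psi> holomorphic_on ball z e"
        unfolding e_def using e2 e3 by (auto intro: holomorphic_on_subset)
      have "residue (\<lambda>w. (h (\<psi> w) * deriv \<psi> w) / (\<psi> w - ?t)) z = (h ?t * deriv \<psi> z) / deriv \<psi> z"
      proof (rule residue_simple_pole_deriv[of _ "ball z e"])
        show "((\<lambda>w. \<psi> w - ?t) has_field_derivative deriv \<psi> z) (at z)"
          using \<psi>' by (auto intro!: derivative_eq_intros)
      qed (use e \<psi>(2) h in \<open>auto intro!: holomorphic_intros\<close>)
      then show ?thesis using \<psi>(2) by simp
    qed
    have "residue (\<lambda>w. g (\<psi> w) * deriv \<psi> w / (\<psi> w - ?t)) z = g ?t"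
    proof (cases "g ?t = 0")
      case True
      \<comment> \<open>The formula for simple poles asks for a numerator that does not vanish, so
        \<open>g\<close> is written as \<open>(g + 1) - 1\<close>.\<close>
      have "residue (\<lambda>w. g (\<psi> w) * deriv \<psi> w / (\<psi> w - ?t)) z =
          residue (\<lambda>w. (g (\<psi> w) + 1) * deriv \<psi> w / (\<psi> w - ?t) + (-1) * (1 * deriv \<psi> w / (\<psi> w - ?t))) z"
        by (intro arg_cong2[where f = residue] refl ext) (simp add: algebra_simps flip: add_divide_distrib)
      also have "\<dots> = residue (\<lambda>w. (g (\<psi> w) + 1) * deriv \<psi> w / (\<psi> w - ?t)) z
          + (-1) * residue (\<lambda>w. 1 * deriv \<psi> w / (\<psi> w - ?t)) z"
        by (subst residue_meromorphic_add; (subst residue_meromorphic_cmult)?)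
          (intro meromorphic_intros analytic_on_imp_meromorphic_on[OF g\<psi>]
            analytic_on_imp_meromorphic_on[OF \<psi>(1)] | rule refl)+
      also have "residue (\<lambda>w. (g (\<psi> w) + 1) * deriv \<psi> w / (\<psi> w - ?t)) z = 1"
        using *[of "\<lambda>x. g x + 1"] True Suc.prems by (simp add: analytic_intros)
      also have "residue (\<lambda>w. 1 * deriv \<psi> w / (\<psi> w - ?t)) z = 1"
        using *[of "\<lambda>x. 1"] by simp
      finally show ?thesis using True by simp
    qed (use * Suc.prems in auto)
    moreover obtain e1 where e1: "e1 > 0" "g holomorphic_on ball ?t e1"
      using Suc.prems by (auto simp: analytic_on_def)
    have "residue (\<lambda>w. g w / (w - ?t)) ?t = g ?t"
      by (rule residue_simple[of "ball ?t e1"]) (use e1 in auto)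
    ultimately show ?thesis using 0 by simp
  next
    case (Suc l)
    let ?h = "deriv g"
    have h: "?h analytic_on {?t}" using Suc.prems by (intro analytic_intros)
    have h\<psi>: "(\<lambda>w. ?h (\<psi> w)) analytic_on {z}"
      using analytic_on_compose[OF \<psi>(1), of ?h] h by (simp add: o_def)
    note mero = analytic_on_imp_meromorphic_on[OF g\<psi>] analytic_on_imp_meromorphic_on[OF h\<psi>]
      analytic_on_imp_meromorphic_on[OF \<psi>(1)] analytic_on_imp_meromorphic_on[OF h]
      analytic_on_imp_meromorphic_on[OF Suc.prems]
    have ev_g: "\<forall>\<^sub>F t in nhds ?t. g analytic_on {t}"
      using Suc.prems by (simp add: eventually_analytic_at)
    have ev_\<psi>: "\<forall>\<^sub>F w in nhds z. \<psi> analytic_on {w}"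
      using \<psi>(1) by (simp add: eventually_analytic_at)
    have tend: "(\<psi> \<longlongrightarrow> ?t) (nhds z)"
      using \<psi>' DERIV_isCont isCont_def tendsto_at_iff_tendsto_nhds by blast
    have ev_g\<psi>: "\<forall>\<^sub>F w in nhds z. g analytic_on {\<psi> w}"
      using eventually_compose_filterlim[OF ev_g tend] .
    have ne: "\<forall>\<^sub>F w in at z. \<psi> w \<noteq> ?t"
      using filterlim_at_deriv_nonzero[OF \<psi>' \<psi>(2)] by (simp add: filterlim_at)
    have A: "residue (deriv (\<lambda>t. g t / (t - ?t) ^ n)) ?t = 0"
      by (intro residue_meromorphic_deriv meromorphic_intros mero)
    have B: "residue (deriv (\<lambda>w. g (\<psi> w) / (\<psi> w - ?t) ^ n)) z = 0"
      by (intro residue_meromorphic_deriv meromorphic_intros mero)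
    have "residue (deriv (\<lambda>t. g t / (t - ?t) ^ n)) ?t =
        residue (\<lambda>t. ?h t / (t - ?t) ^ n + (- of_nat n) * (g t / (t - ?t) ^ Suc n)) ?t"
    proof (rule residue_cong)
      have "\<forall>\<^sub>F t in at ?t. t \<noteq> ?t" by (simp add: eventually_at_filter)
      moreover have "\<forall>\<^sub>F t in at ?t. g analytic_on {t}"
        using ev_g by (simp add: eventually_at_filter eventually_mono)
      ultimately show "\<forall>\<^sub>F t in at ?t. deriv (\<lambda>t. g t / (t - ?t) ^ n) t =
          ?h t / (t - ?t) ^ n + (- of_nat n) * (g t / (t - ?t) ^ Suc n)"
      proof eventually_elim
        case (elim t)
        have d: "((\<lambda>t. t - ?t) has_field_derivative 1) (at t)"
          by (auto intro!: derivative_eq_intros)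
        have "((\<lambda>t. g t / (t - ?t) ^ n) has_field_derivative
            ?h t / (t - ?t) ^ n + (- of_nat n) * (g t / (t - ?t) ^ Suc n)) (at t)"
          using has_field_derivative_over_power[of g "?h t" t "\<lambda>t. t - ?t" 1 n, OF analytic_derivI[OF elim(2)]]
            d elim by simp
        then show ?case by (rule DERIV_imp_deriv)
      qed
    qed simp
    also have "\<dots> = residue (\<lambda>t. ?h t / (t - ?t) ^ n) ?t + (- of_nat n) * residue (\<lambda>t. g t / (t - ?t) ^ Suc n) ?t"
      by (subst residue_meromorphic_add; (subst residue_meromorphic_cmult)?)
        (intro meromorphic_intros mero | rule refl)+
    finally have A': "residue (\<lambda>t. ?h t / (t - ?t) ^ n) ?t = of_nat n * residue (\<lambda>t. g t / (t - ?t) ^ Suc n) ?t"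
      using A by simp
    have "residue (deriv (\<lambda>w. g (\<psi> w) / (\<psi> w - ?t) ^ n)) z =
        residue (\<lambda>w. ?h (\<psi> w) / (\<psi> w - ?t) ^ n * deriv \<psi> w + (- of_nat n) * (g (\<psi> w) / (\<psi> w - ?t) ^ Suc n * deriv \<psi> w)) z"
    proof (rule residue_cong)
      have "\<forall>\<^sub>F w in at z. \<psi> analytic_on {w}" "\<forall>\<^sub>F w in at z. g analytic_on {\<psi> w}"
        using ev_\<psi> ev_g\<psi> by (simp_all add: eventually_at_filter eventually_mono)
      then show "\<forall>\<^sub>F w in at z. deriv (\<lambda>w. g (\<psi> w) / (\<psi> w - ?t) ^ n) w =
          ?h (\<psi> w) / (\<psi> w - ?t) ^ n * deriv \<psi> w + (- of_nat n) * (g (\<psi> w) / (\<psi> w - ?t) ^ Suc n * deriv \<psi> w)"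
        using ne
      proof eventually_elim
        case (elim w)
        have "((\<lambda>w. g (\<psi> w)) has_field_derivative ?h (\<psi> w) * deriv \<psi> w) (at w)"
          using DERIV_chain2[OF analytic_derivI[OF elim(2)] analytic_derivI[OF elim(1)]] .
        then have "((\<lambda>w. g (\<psi> w) / (\<psi> w - ?t) ^ n) has_field_derivative
            ?h (\<psi> w) / (\<psi> w - ?t) ^ n * deriv \<psi> w + (- of_nat n) * (g (\<psi> w) / (\<psi> w - ?t) ^ Suc n * deriv \<psi> w)) (at w)"
          using has_field_derivative_over_power[of "\<lambda>w. g (\<psi> w)" _ w "\<lambda>w. \<psi> w - ?t" "deriv \<psi> w" n]
            DERIV_diff[OF analytic_derivI[OF elim(1)] DERIV_const, of "?t"] elim(3) by simp
        then show ?case by (rule DERIV_imp_deriv)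
      qed
    qed simp
    also have "\<dots> = residue (\<lambda>w. ?h (\<psi> w) / (\<psi> w - ?t) ^ n * deriv \<psi> w) z
        + (- of_nat n) * residue (\<lambda>w. g (\<psi> w) / (\<psi> w - ?t) ^ Suc n * deriv \<psi> w) z"
      by (subst residue_meromorphic_add; (subst residue_meromorphic_cmult)?)
        (intro meromorphic_intros mero | rule refl)+
    finally have B': "residue (\<lambda>w. ?h (\<psi> w) / (\<psi> w - ?t) ^ n * deriv \<psi> w) z =
        of_nat n * residue (\<lambda>w. g (\<psi> w) / (\<psi> w - ?t) ^ Suc n * deriv \<psi> w) z"
      using B by simp
    have "of_nat n * residue (\<lambda>w. g (\<psi> w) / (\<psi> w - ?t) ^ Suc n * deriv \<psi> w) z =
        of_nat n * residue (\<lambda>t. g t / (t - ?t) ^ Suc n) ?t"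
      using Suc.IH[OF h] A' B' by metis
    moreover from Suc have ne: "(of_nat n :: complex) \<noteq> 0" using Suc by (simp del: of_nat_Suc)
    ultimately show ?thesis unfolding mult_left_cancel[OF ne] by - assumption
  qed
qed

lemma residue_substitution:
  assumes "f meromorphic_on {\<psi> z}" and \<psi>: "\<psi> analytic_on {z}" "deriv \<psi> z \<noteq> 0"
  shows "residue (\<lambda>w. f (\<psi> w) * deriv \<psi> w) z = residue f (\<psi> z)"
proof -
  obtain g N where g: "g analytic_on {\<psi> z}" "\<forall>\<^sub>F t in at (\<psi> z). f t = g t / (t - \<psi> z) ^ N"
    using meromorphic_at_factor[OF assms(1)] .
  have lim: "filterlim \<psi> (at (\<psi> z)) (at z)"
    using filterlim_at_deriv_nonzero[OF analytic_derivI[OF \<psi>(1)] \<psi>(2)] .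
  have "residue (\<lambda>w. f (\<psi> w) * deriv \<psi> w) z = residue (\<lambda>w. g (\<psi> w) / (\<psi> w - \<psi> z) ^ N * deriv \<psi> w) z"
    by (rule residue_cong) (use lim g(2) in \<open>auto simp: filterlim_iff elim!: eventually_mono\<close>)
  also have "\<dots> = residue (\<lambda>t. g t / (t - \<psi> z) ^ N) (\<psi> z)"
    by (rule residue_substitution_aux) (use assms g in auto)
  also have "\<dots> = residue f (\<psi> z)"
    by (rule residue_cong) (use g(2) in \<open>auto elim: eventually_mono\<close>)
  finally show ?thesis .
qed

section \<open>Elimination of the integration variables\<close>

text \<open>Quotient of consecutive coefficients of \<open>w(x,y)\<close>: passing from
  \<open>exp ((d + y) x)\<close> to \<open>exp ((d + 1 + y) x)\<close> multiplies the coefficient by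
  \<open>hg_ratio k (d + y)\<close>.\<close>

definition hg_ratio :: "nat \<Rightarrow> complex \<Rightarrow> complex" where
  "hg_ratio k s = (\<Prod>j=1..k. of_nat k * s + of_nat j) / (s + 1) ^ k"

text \<open>
  In the coordinate \<open>t = z\<^sub>i / (z\<^sub>i - z\<^sub>i\<^sub>+\<^sub>1)\<close> the edge factor \<open>e_edge k z\<^sub>i z\<^sub>i\<^sub>+\<^sub>1 / (k z\<^sub>i z\<^sub>i\<^sup>k)\<close> becomes
  \<open>kernel k m t\<close> for \<open>k = 2 m + 1\<close>, up to the powers of \<open>z\<^sub>i\<close> and \<open>z\<^sub>i\<^sub>+\<^sub>1\<close> dictated by homogeneity, and
  the elimination of \<open>z\<^sub>i\<close> becomes \<open>kres\<close>. The pole \<open>z\<^sub>i = 0\<close> corresponds to \<open>t = 0\<close>, and the pole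
  \<open>z\<^sub>i = z\<^sub>i\<^sub>+\<^sub>1 / (2 - r)\<close> with \<open>r = c / (c + 1)\<close> to \<open>t = -(c + 1)\<close>; here \<open>c\<close> counts the poles of the second
  kind taken since the last residue at \<open>0\<close>.
\<close>

definition kernel :: "nat \<Rightarrow> nat \<Rightarrow> complex \<Rightarrow> complex" where
  "kernel k m t = (t / (t - 1)) ^ m * hg_ratio k (t - 1)"

definition kres :: "nat \<Rightarrow> nat \<Rightarrow> complex \<Rightarrow> (complex \<Rightarrow> complex) \<Rightarrow> complex \<Rightarrow> complex" where
  "kres k m p \<phi> y = residue (\<lambda>t. kernel k m t * \<phi> t / (y + 1 - t)) p"

text \<open>The shape of \<open>iter_residue\<close> after the change of coordinate; the last
  integration becomes evaluation at 0.\<close>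

primrec branch :: "nat \<Rightarrow> nat \<Rightarrow> nat \<Rightarrow> nat \<Rightarrow> (complex \<Rightarrow> complex) \<Rightarrow> complex" where
  "branch k m 0 c \<phi> = \<phi> 0"
| "branch k m (Suc n) c \<phi> = branch k m n 0 (kres k m 0 \<phi>) +
     branch k m n (Suc c) (kres k m (- of_nat (Suc c)) \<phi>)"

text \<open>Replaces the branching by one linear operator: the sum runs over all points that a
  branch could meet, and those without a pole add 0.\<close>

definition ktot :: "nat \<Rightarrow> nat \<Rightarrow> nat \<Rightarrow> (complex \<Rightarrow> complex) \<Rightarrow> complex \<Rightarrow> complex" where
  "ktot k m M \<phi> y = (\<Sum>p\<le>M. kres k m (- of_nat p) \<phi> y)"

lemma kernel_meromorphic: "kernel k m meromorphic_on A"
  unfolding kernel_def hg_ratio_def by (intro meromorphic_intros)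

lemma kernel_analytic: "t \<noteq> 0 \<Longrightarrow> t \<noteq> 1 \<Longrightarrow> kernel k m analytic_on {t}"
  unfolding kernel_def hg_ratio_def by (intro analytic_intros) auto

text \<open>Distinct half-integers are at least \<open>1 / 2\<close> apart, so residues do not see
  the values taken at them.\<close>

lemma eventually_not_half_int: "\<forall>\<^sub>F t in at (p :: complex). 2 * t \<notin> \<int>"
proof (cases "2 * p \<in> \<int>")
  case True
  have "2 * t \<notin> \<int>" if "t \<noteq> p" "dist t p < 1 / 2" for t
  proof
    assume "2 * t \<in> \<int>"
    then have "2 * t - 2 * p \<in> \<int>" using True by (intro Ints_diff)
    then obtain i where i: "2 * t - 2 * p = of_int i" by (auto elim: Ints_cases)
    have "norm (2 * (t - p)) = 2 * norm (t - p)"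
      by (simp only: norm_mult norm_numeral)
    then have "norm (2 * (t - p)) < 1"
      using that(2) by (simp add: dist_norm del: norm_mult)
    then have "\<bar>i\<bar> < 1"
      unfolding right_diff_distrib i by simp
    then show False using i that(1) by simp
  qed
  then show ?thesis unfolding eventually_at by (intro exI[of _ "1/2"]) auto
next
  case False
  have "open {t :: complex. 2 * t \<notin> \<int>}"
  proof -
    have "open ((\<lambda>t :: complex. 2 * t) -` (- \<int>))"
      by (intro open_vimage continuous_intros) (auto simp: open_Compl closed_Ints)
    then show ?thesis by (simp add: vimage_def)
  qed
  then have "\<forall>\<^sub>F t in nhds p. 2 * t \<notin> \<int>"
    using False eventually_nhds_in_open[of "{t. 2 * t \<notin> \<int>}" p] by simp
  then show ?thesis by (simp add: eventually_at_filter eventually_mono)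
qed

text \<open>Equality off the half-integers, where values may be junk (only \<open>0\<close> matters in the end).\<close>

definition agree :: "(complex \<Rightarrow> complex) \<Rightarrow> (complex \<Rightarrow> complex) \<Rightarrow> bool" where
  "agree \<phi> \<psi> \<longleftrightarrow> (\<forall>y. 2 * y \<notin> \<int> \<or> y = 0 \<longrightarrow> \<phi> y = \<psi> y)"

lemma agree_refl [simp]: "agree \<phi> \<phi>"
  by (simp add: agree_def)

lemma agree_at_0: "agree \<phi> \<psi> \<Longrightarrow> \<phi> 0 = \<psi> 0"
  by (simp add: agree_def)

lemma agree_eventually: "agree \<phi> \<psi> \<Longrightarrow> \<forall>\<^sub>F t in at p. \<phi> t = \<psi> t"
  using eventually_not_half_int[of p] by eventually_elim (auto simp: agree_def)

lemma kres_cong: "agree \<phi> \<psi> \<Longrightarrow> kres k m p \<phi> = kres k m p \<psi>"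
  unfolding kres_def
  by (intro ext residue_cong refl) (auto dest: agree_eventually[of _ _ p] elim: eventually_mono)

lemma ktot_cong: "agree \<phi> \<psi> \<Longrightarrow> ktot k m M \<phi> = ktot k m M \<psi>"
  unfolding ktot_def by (simp add: kres_cong)

lemma kres_add:
  assumes "f meromorphic_on UNIV" "g meromorphic_on UNIV"
  shows "kres k m p (\<lambda>t. f t + g t) y = kres k m p f y + kres k m p g y"
proof -
  note M = meromorphic_on_subset[OF assms(1) subset_UNIV] meromorphic_on_subset[OF assms(2) subset_UNIV]
    kernel_meromorphic
  have "kres k m p (\<lambda>t. f t + g t) y =
      residue (\<lambda>t. kernel k m t * f t / (y + 1 - t) + kernel k m t * g t / (y + 1 - t)) p"
    unfolding kres_def by (simp add: distrib_left add_divide_distrib)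
  then show ?thesis
    unfolding kres_def by (subst (asm) residue_meromorphic_add; (intro meromorphic_intros M)?)
qed

lemma ktot_add:
  assumes "f meromorphic_on UNIV" "g meromorphic_on UNIV"
  shows "ktot k m M (\<lambda>t. f t + g t) y = ktot k m M f y + ktot k m M g y"
  unfolding ktot_def by (simp add: kres_add[OF assms] sum.distrib)

text \<open>The factor \<open>1 / (y + 1 - t)\<close> is a geometric series in
  \<open>(t - p) / (y + 1 - p)\<close>, and only its first \<open>N\<close> terms meet the pole of
  order at most \<open>N\<close> of the other factors. As a function of \<open>y\<close> the result
  can have a pole only at \<open>p - 1\<close>.\<close>

lemma kres_expansion:
  assumes "\<phi> meromorphic_on UNIV"
  obtains N c where "\<And>y. y \<noteq> p - 1 \<Longrightarrow> kres k m p \<phi> y = (\<Sum>l<N. c l / (y + 1 - p) ^ Suc l)"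
proof -
  define h where "h = (\<lambda>t. kernel k m t * \<phi> t)"
  note M = meromorphic_on_subset[OF assms subset_UNIV] kernel_meromorphic
  have h: "h meromorphic_on {p}"
    unfolding h_def by (intro meromorphic_intros M)
  obtain g N where g: "g analytic_on {p}" "\<forall>\<^sub>F t in at p. h t = g t / (t - p) ^ N"
    using meromorphic_at_factor[OF h] .
  have geom: "1 / (Y - s) = (\<Sum>l<n. s ^ l / Y ^ Suc l) + s ^ n / (Y ^ n * (Y - s))"
    if "Y \<noteq> 0" "Y \<noteq> s" for Y s :: complex and n
  proof (induction n)
    case (Suc n)
    have "s ^ n / (Y ^ n * (Y - s)) = s ^ n / Y ^ Suc n + s ^ Suc n / (Y ^ Suc n * (Y - s))"
      using that by (simp add: divide_simps) (simp add: algebra_simps)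
    with Suc show ?case by simp
  qed simp
  have "kres k m p \<phi> y = (\<Sum>l<N. residue (\<lambda>t. h t * (t - p) ^ l) p / (y + 1 - p) ^ Suc l)"
    if y: "y \<noteq> p - 1" for y
  proof -
    let ?Y = "y + 1 - p"
    have Y: "?Y \<noteq> 0" using y by (auto simp: algebra_simps)
    have ne: "\<forall>\<^sub>F t in at p. t \<noteq> y + 1"
      using Y tendsto_imp_eventually_ne[OF tendsto_ident_at, of p "y + 1" UNIV] by auto
    have "kres k m p \<phi> y = residue (\<lambda>t. (\<Sum>l<N. 1 / ?Y ^ Suc l * (h t * (t - p) ^ l)) + g t / (?Y ^ N * (y + 1 - t))) p"
      unfolding kres_def
    proof (rule residue_cong)
      have "\<forall>\<^sub>F t in at p. t \<noteq> p" by (simp add: eventually_at_filter)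
      then show "\<forall>\<^sub>F t in at p. kernel k m t * \<phi> t / (y + 1 - t) =
          (\<Sum>l<N. 1 / ?Y ^ Suc l * (h t * (t - p) ^ l)) + g t / (?Y ^ N * (y + 1 - t))"
        using g(2) ne
      proof eventually_elim
        case (elim t)
        have "kernel k m t * \<phi> t / (y + 1 - t) = h t * (1 / (?Y - (t - p)))"
          by (simp add: h_def)
        also have "\<dots> = h t * (\<Sum>l<N. (t - p) ^ l / ?Y ^ Suc l) + h t * (t - p) ^ N / (?Y ^ N * (y + 1 - t))"
        proof -
          have "?Y \<noteq> t - p" using elim(3) by (auto simp: algebra_simps)
          moreover have "?Y - (t - p) = y + 1 - t" by simp
          ultimately show ?thesis
            using geom[of ?Y "t - p" N] Y by (metis (no_types, lifting) distrib_left times_divide_eq_right)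
        qed
        also have "h t * (t - p) ^ N = g t" using elim by simp
        finally show ?case by (simp add: sum_distrib_left mult_ac)
      qed
    qed simp
    also have "\<dots> = residue (\<lambda>t. \<Sum>l<N. 1 / ?Y ^ Suc l * (h t * (t - p) ^ l)) p + residue (\<lambda>t. g t / (?Y ^ N * (y + 1 - t))) p"
      by (intro residue_meromorphic_add meromorphic_intros h analytic_on_imp_meromorphic_on[OF g(1)])
    also have "residue (\<lambda>t. g t / (?Y ^ N * (y + 1 - t))) p = 0"
      by (intro residue_analytic analytic_intros g(1)) (use Y in auto)
    also have "residue (\<lambda>t. \<Sum>l<N. 1 / ?Y ^ Suc l * (h t * (t - p) ^ l)) p =
        (\<Sum>l<N. 1 / ?Y ^ Suc l * residue (\<lambda>t. h t * (t - p) ^ l) p)"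
      by (subst residue_meromorphic_sum; (subst residue_meromorphic_cmult)?)
        (intro meromorphic_intros h refl finite_lessThan)+
    finally show ?thesis by simp
  qed
  then show ?thesis using that[where N = N and c = "\<lambda>l. residue (\<lambda>t. h t * (t - p) ^ l) p"] by blast
qed

lemma kres_analytic:
  assumes "\<phi> meromorphic_on UNIV" "y \<noteq> p - 1"
  shows "kres k m p \<phi> analytic_on {y}"
proof -
  obtain N c where Nc: "\<And>y. y \<noteq> p - 1 \<Longrightarrow> kres k m p \<phi> y = (\<Sum>l<N. c l / (y + 1 - p) ^ Suc l)"
    using kres_expansion[OF assms(1), of p k m] by blast
  have "\<forall>\<^sub>F y in nhds y. y \<noteq> p - 1"
    using assms(2) by (simp add: t1_space_nhds)
  then have ev: "\<forall>\<^sub>F y in nhds y. kres k m p \<phi> y = (\<Sum>l<N. c l / (y + 1 - p) ^ Suc l)"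
    by eventually_elim (rule Nc)
  have "(\<lambda>y. \<Sum>l<N. c l / (y + 1 - p) ^ Suc l) analytic_on {y}"
    by (intro analytic_intros) (use assms(2) in \<open>auto simp: diff_eq_eq eq_diff_eq simp del: power_Suc\<close>)
  then show ?thesis using analytic_at_cong[OF ev refl] by simp
qed

lemma kres_meromorphic:
  assumes "\<phi> meromorphic_on UNIV"
  shows "kres k m p \<phi> meromorphic_on A"
proof -
  obtain N c where Nc: "\<And>y. y \<noteq> p - 1 \<Longrightarrow> kres k m p \<phi> y = (\<Sum>l<N. c l / (y + 1 - p) ^ Suc l)"
    using kres_expansion[OF assms(1), of p k m] by blast
  have "(\<lambda>y. \<Sum>l<N. c l / (y + 1 - p) ^ Suc l) meromorphic_on A"
    by (intro meromorphic_intros)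
  moreover have "\<forall>\<^sub>F y in at z. kres k m p \<phi> y = (\<Sum>l<N. c l / (y + 1 - p) ^ Suc l)" for z
  proof -
    have "\<forall>\<^sub>F y in at z. y \<noteq> p - 1"
      by (rule eventually_neq_at_within)
    then show ?thesis by eventually_elim (rule Nc)
  qed
  ultimately show ?thesis
    by (subst meromorphic_on_cong[OF _ refl])
qed

lemma ktot_meromorphic: "\<phi> meromorphic_on UNIV \<Longrightarrow> ktot k m M \<phi> meromorphic_on A"
  unfolding ktot_def by (intro meromorphic_intros kres_meromorphic)

lemma ktot_pow_meromorphic: "\<phi> meromorphic_on UNIV \<Longrightarrow> (ktot k m M ^^ n) \<phi> meromorphic_on UNIV"
  by (induction n) (auto intro: ktot_meromorphic)

lemma ktot_pow_cong: "agree \<phi> \<psi> \<Longrightarrow> agree ((ktot k m M ^^ n) \<phi>) ((ktot k m M ^^ n) \<psi>)"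
  by (induction n) (auto simp: ktot_cong)

lemma ktot_pow_add:
  assumes "f meromorphic_on UNIV" "g meromorphic_on UNIV"
  shows "(ktot k m M ^^ n) (\<lambda>t. f t + g t) = (\<lambda>y. (ktot k m M ^^ n) f y + (ktot k m M ^^ n) g y)"
proof (induction n)
  case (Suc n)
  have "(ktot k m M ^^ Suc n) (\<lambda>t. f t + g t) = ktot k m M (\<lambda>y. (ktot k m M ^^ n) f y + (ktot k m M ^^ n) g y)"
    using Suc.IH by simp
  then show ?case
    using ktot_add[OF ktot_pow_meromorphic[OF assms(1)] ktot_pow_meromorphic[OF assms(2)]] by auto
qed simp

lemma kres_eq_0:
  assumes "\<phi> analytic_on {p}" "p \<noteq> 0" "p \<noteq> 1" "y + 1 \<noteq> p"
  shows "kres k m p \<phi> y = 0"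
  unfolding kres_def by (intro residue_analytic analytic_intros kernel_analytic assms) (use assms in auto)

lemma half_int_or_0_neq:
  assumes "2 * y \<notin> \<int> \<or> y = 0"
  shows "y + 1 \<noteq> (- of_nat p :: complex)"
proof
  assume "y + 1 = - of_nat p"
  then have y: "y = - of_nat (Suc p)" by (simp add: eq_diff_eq[symmetric])
  then have "2 * y \<in> \<int>" "y \<noteq> 0" by (auto intro!: Ints_mult simp del: of_nat_Suc)
  with assms show False by blast
qed

lemma agree_ktot_branch:
  assumes "\<And>p. p \<noteq> Suc c \<Longrightarrow> p \<noteq> 0 \<Longrightarrow> \<phi> analytic_on {- of_nat p}" "Suc c \<le> M"
  shows "agree (ktot k m M \<phi>) (\<lambda>y. kres k m 0 \<phi> y + kres k m (- of_nat (Suc c)) \<phi> y)"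
  unfolding agree_def
proof (intro allI impI)
  fix y :: complex assume y: "2 * y \<notin> \<int> \<or> y = 0"
  have "ktot k m M \<phi> y = (\<Sum>p\<in>{0, Suc c}. kres k m (- of_nat p) \<phi> y)"
    unfolding ktot_def
  proof (rule sum.mono_neutral_right)
    show "\<forall>i\<in>{..M} - {0, Suc c}. kres k m (- of_nat i) \<phi> y = 0"
    proof
      fix i assume "i \<in> {..M} - {0, Suc c}"
      then have i: "i \<noteq> 0" "i \<noteq> Suc c" by auto
      have "- of_nat i \<noteq> (1 :: complex)"
        by (simp add: complex_eq_iff)
      then show "kres k m (- of_nat i) \<phi> y = 0"
        by (intro kres_eq_0 assms half_int_or_0_neq y) (use i in auto)
    qed
  qed (use assms(2) in auto)
  then show "ktot k m M \<phi> y = kres k m 0 \<phi> y + kres k m (- of_nat (Suc c)) \<phi> y" by simp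
qed

text \<open>By \<open>kres_analytic\<close>, a residue at \<open>p\<close> leaves a function whose
  only pole can be at \<open>p - 1\<close>: at \<open>-1\<close> after a residue at 0, at
  \<open>-(c + 2)\<close> after one at \<open>-(c + 1)\<close>. This invariant makes the other terms
  of \<open>ktot\<close> vanish, and \<open>c + n \<le> M\<close> keeps the poles within its
  range.\<close>

lemma branch_eq_ktot:
  assumes "\<phi> meromorphic_on UNIV"
    and "\<And>p. p \<noteq> Suc c \<Longrightarrow> p \<noteq> 0 \<Longrightarrow> \<phi> analytic_on {- of_nat p}" "c + n \<le> M"
  shows "branch k m n c \<phi> = (ktot k m M ^^ n) \<phi> 0"
  using assms
proof (induction n arbitrary: c \<phi>)
  case (Suc n)
  let ?f = "kres k m 0 \<phi>" and ?g = "kres k m (- of_nat (Suc c)) \<phi>"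
  have mero: "?f meromorphic_on UNIV" "?g meromorphic_on UNIV"
    by (rule kres_meromorphic[OF Suc.prems(1)])+
  have "branch k m n 0 ?f = (ktot k m M ^^ n) ?f 0"
  proof (rule Suc.IH[OF mero(1)])
    fix p :: nat assume p: "p \<noteq> Suc 0" "p \<noteq> 0"
    then have "- of_nat p \<noteq> (0 - 1 :: complex)"
      by (simp add: complex_eq_iff)
    then show "?f analytic_on {- of_nat p}"
      by (rule kres_analytic[OF Suc.prems(1)])
  qed (use Suc.prems in simp)
  moreover have "branch k m n (Suc c) ?g = (ktot k m M ^^ n) ?g 0"
  proof (rule Suc.IH[OF mero(2)])
    fix p :: nat assume p: "p \<noteq> Suc (Suc c)" "p \<noteq> 0"
    then have "real p \<noteq> real (Suc c) + 1"
      by linarith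
    then have "- of_nat p \<noteq> (- of_nat (Suc c) - 1 :: complex)"
      by (simp add: complex_eq_iff)
    then show "?g analytic_on {- of_nat p}"
      by (rule kres_analytic[OF Suc.prems(1)])
  qed (use Suc.prems in simp)
  moreover have "(ktot k m M ^^ Suc n) \<phi> 0 = (ktot k m M ^^ n) (ktot k m M \<phi>) 0"
    by (simp add: funpow_swap1)
  moreover have "agree (ktot k m M \<phi>) (\<lambda>y. ?f y + ?g y)"
    by (rule agree_ktot_branch) (use Suc.prems in auto)
  then have "(ktot k m M ^^ n) (ktot k m M \<phi>) 0 = (ktot k m M ^^ n) (\<lambda>y. ?f y + ?g y) 0"
    by (intro agree_at_0 ktot_pow_cong)
  ultimately show ?case
    unfolding ktot_pow_add[OF mero] by simp
qed simp

section \<open>From residues in several variables to operators in one variable\<close>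

text \<open>
  The part of the integrand that involves \<open>z\<^sub>i, \<dots>, z\<^sub>i\<^sub>+\<^sub>n\<close>, apart from the factors that have been
  affected by the elimination of \<open>z\<^sub>0, \<dots>, z\<^sub>i\<^sub>-\<^sub>1\<close>.
\<close>

primrec chain_rest :: "nat \<Rightarrow> nat \<Rightarrow> nat \<Rightarrow> nat \<Rightarrow> (nat \<Rightarrow> complex) \<Rightarrow> complex" where
  "chain_rest k m 0 i z = z i ^ (m - 1) / z i ^ k"
| "chain_rest k m (Suc n) i z = 1 / z i ^ k * e_edge k (z i) (z (Suc i)) / (of_nat k * z i) *
     (if n = 0 then 1 else 1 / (2 * z (Suc i) - z i - z (Suc (Suc i)))) * chain_rest k m n (Suc i) z"

text \<open>By homogeneity the eliminated part is a power of \<open>z i\<close> times a function of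
  the ratio of \<open>z i\<close> and \<open>z (i + 1)\<close>. The last variable has no successor;
  there \<open>t = 0\<close> corresponds to \<open>z (i + 1)\<close> at infinity.\<close>

definition stage :: "nat \<Rightarrow> nat \<Rightarrow> nat \<Rightarrow> nat \<Rightarrow> (complex \<Rightarrow> complex) \<Rightarrow> (nat \<Rightarrow> complex) \<Rightarrow> complex" where
  "stage k m n i \<phi> z = chain_rest k m n i z * z i ^ Suc m *
     (if n = 0 then \<phi> 0 else \<phi> (z i / (z i - z (Suc i))) / (z i - z (Suc i)))"

definition generic :: "nat \<Rightarrow> nat \<Rightarrow> (nat \<Rightarrow> complex) \<Rightarrow> bool" where
  "generic n i z \<longleftrightarrow> (\<forall>l\<in>{i..i+n}. z l \<noteq> 0) \<and> (\<forall>l\<in>{i..<i+n}. z l \<noteq> z (Suc l))"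

lemma chain_rest_upd [simp]: "l < i \<Longrightarrow> chain_rest k m n i (z(l := t)) = chain_rest k m n i z"
  by (induction n arbitrary: i) auto

lemma generic_upd:
  "generic (Suc n) i (z(i := t)) \<longleftrightarrow> generic n (Suc i) z \<and> t \<noteq> 0 \<and> t \<noteq> z (Suc i)"
proof -
  have "{i..i + Suc n} = insert i {Suc i..Suc i + n}" "{i..<i + Suc n} = insert i {Suc i..<Suc i + n}"
    by auto
  then show ?thesis by (auto simp: generic_def)
qed

lemma prod_shift_edge:
  "(\<Prod>j=0..k. of_nat j * u + (of_nat k - of_nat j) * w) =
    of_nat k * w * (\<Prod>j=1..k. of_nat j * u + (of_nat k - of_nat j) * (w :: complex))"
  by (simp add: prod.atLeast_Suc_atMost)

lemma kernel_moebius: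
  assumes "u \<noteq> w" "u \<noteq> 0" "w \<noteq> 0"
  shows "of_nat k * w * kernel k m (u / (u - w)) = (u / w) ^ m * e_edge k u w / u ^ k"
proof -
  have 1: "u / (u - w) - 1 = w / (u - w)" and 2: "w / (u - w) + 1 = u / (u - w)"
    using assms by (simp_all add: field_simps)
  have "hg_ratio k (w / (u - w)) = (\<Prod>j=1..k. (of_nat j * u + (of_nat k - of_nat j) * w) / (u - w)) / (u / (u - w)) ^ k"
    unfolding hg_ratio_def 2
    by (intro arg_cong2[where f = "(/)"] prod.cong refl) (use assms in \<open>simp add: field_simps\<close>)
  also have "\<dots> = (\<Prod>j=1..k. of_nat j * u + (of_nat k - of_nat j) * w) / u ^ k"
    using assms by (simp add: prod_dividef power_divide)
  finally have "hg_ratio k (w / (u - w)) = (\<Prod>j=1..k. of_nat j * u + (of_nat k - of_nat j) * w) / u ^ k" .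
  moreover have "u / (u - w) / (w / (u - w)) = u / w"
    using assms by simp
  ultimately show ?thesis
    unfolding kernel_def 1 e_edge_def prod_shift_edge by (simp only: mult.assoc mult.left_commute times_divide_eq_right)
qed

text \<open>The substitution \<open>t = u / (u - w)\<close> with \<open>w = z (i + 1)\<close>
  carries \<open>u = p / (p - 1) * w\<close> to \<open>t = p\<close>, and \<open>t = 1\<close> would
  be \<open>u\<close> at infinity. By \<open>residue_substitution\<close> the form of
  \<open>stage\<close> is preserved.\<close>

lemma residue_var_stage:
  assumes G: "\<And>z. generic (Suc n) i z \<Longrightarrow> G z = stage k m (Suc n) i \<phi> z"
    and mero: "\<phi> meromorphic_on UNIV" and p: "p \<noteq> 1" and k: "k > 0" and gen: "generic n (Suc i) z"
    and P: "P z = p / (p - 1) * z (Suc i)"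
  shows "residue_var i P G z = stage k m n (Suc i) (kres k m p \<phi>) z"
proof -
  define w where "w = z (Suc i)"
  define w' where "w' = z (Suc (Suc i))"
  define y where "y = (if n = 0 then 0 else w / (w - w'))"
  define v where "v = (if n = 0 then 1 else w - w')"
  define R where "R = chain_rest k m n (Suc i) z"
  define \<psi> where "\<psi> = (\<lambda>u. u / (u - w))"
  have w: "w \<noteq> 0" "n \<noteq> 0 \<Longrightarrow> w \<noteq> w'"
    using gen by (auto simp: generic_def w_def w'_def)
  then have v: "v \<noteq> 0" by (auto simp: v_def)
  define q where "q = p / (p - 1) * w"
  have q: "q \<noteq> w" "\<psi> q = p"
  proof -
    have "q - w = w / (p - 1)" using p by (simp add: q_def field_simps)
    then show "q \<noteq> w" "\<psi> q = p" using w p by (auto simp: \<psi>_def q_def)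
  qed
  have d\<psi>: "deriv \<psi> u = - w / (u - w) ^ 2" if "u \<noteq> w" for u
    unfolding \<psi>_def
    by (rule DERIV_imp_deriv) (use that in \<open>auto intro!: derivative_eq_intros simp: field_simps power2_eq_square\<close>)
  have a\<psi>: "\<psi> analytic_on {q}"
    unfolding \<psi>_def by (intro analytic_intros) (use q in auto)
  define f where "f = (\<lambda>t. R * w ^ Suc m / v * (kernel k m t * \<phi> t / (y + 1 - t)))"
  have h: "(\<lambda>t. kernel k m t * \<phi> t / (y + 1 - t)) meromorphic_on {p}"
    by (intro meromorphic_intros kernel_meromorphic meromorphic_on_subset[OF mero]) auto
  have f: "f meromorphic_on {\<psi> q}"
    unfolding f_def q(2) by (intro meromorphic_on_mult meromorphic_on_const h)
  have "residue_var i P G z = residue (\<lambda>t. G (z(i := t))) q"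
    by (simp add: residue_var_def P q_def w_def)
  also have "\<dots> = residue (\<lambda>u. f (\<psi> u) * deriv \<psi> u) q"
  proof (rule residue_cong)
    have "\<forall>\<^sub>F u in at q. u \<noteq> 0" "\<forall>\<^sub>F u in at q. u \<noteq> w"
      by (rule eventually_neq_at_within)+
    then show "\<forall>\<^sub>F u in at q. G (z(i := u)) = f (\<psi> u) * deriv \<psi> u"
    proof eventually_elim
      case (elim u)
      define D where "D = (if n = 0 then 1 else 2 * w - u - w')"
      have "generic (Suc n) i (z(i := u))"
        unfolding generic_upd using gen elim by (simp add: w_def)
      then have "G (z(i := u)) = stage k m (Suc n) i \<phi> (z(i := u))" by (rule G)
      also have "\<dots> = 1 / u ^ k * e_edge k u w / (of_nat k * u) * (1 / D) * R * u ^ Suc m *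
          (\<phi> (\<psi> u) / (u - w))"
        by (simp add: stage_def w_def w'_def R_def D_def \<psi>_def)
      also have "\<dots> = ((u / w) ^ m * e_edge k u w / u ^ k) * w ^ m / (of_nat k * D) * R * (\<phi> (\<psi> u) / (u - w))"
        using elim w by (simp add: field_simps)
      also have "\<dots> = of_nat k * w * kernel k m (\<psi> u) * w ^ m / (of_nat k * D) * R * (\<phi> (\<psi> u) / (u - w))"
        unfolding \<psi>_def by (subst kernel_moebius) (use elim w in auto)
      also have "\<dots> = R * w ^ Suc m * kernel k m (\<psi> u) * \<phi> (\<psi> u) * (1 / (D * (u - w)))"
        using k by simp
      \<comment> \<open>Together with the Jacobian, the denominator \<open>D\<close> belonging to
        \<open>z (i + 1)\<close> becomes \<open>y + 1 - t\<close>; if \<open>D = 0\<close>, both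
        sides are 0.\<close>
      also have "1 / (D * (u - w)) = (1 / (v * (y + 1 - \<psi> u))) * deriv \<psi> u"
      proof -
        have "y + 1 - \<psi> u = - w * D / (v * (u - w))"
        proof (cases "n = 0")
          case True
          then show ?thesis using elim by (simp add: y_def v_def D_def \<psi>_def field_simps)
        next
          case False
          then have "w - w' \<noteq> 0" "u - w \<noteq> 0" using w elim by auto
          then show ?thesis using False
            by (simp add: y_def v_def D_def \<psi>_def divide_simps) (simp add: algebra_simps)
        qed
        then show ?thesis unfolding d\<psi>[OF elim(2)] using w v elim
          by (simp add: power2_eq_square)
      qed
      finally show ?case unfolding f_def by (simp only: mult.assoc times_divide_eq_right times_divide_eq_left divide_divide_eq_left mult_1)
    qed
  qed simp
  also have "\<dots> = residue f (\<psi> q)"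
    by (rule residue_substitution[OF f a\<psi>]) (use d\<psi>[OF q(1)] w q in auto)
  also have "\<dots> = R * w ^ Suc m / v * kres k m p \<phi> y"
    unfolding f_def q(2) kres_def by (rule residue_meromorphic_cmult[OF h])
  also have "\<dots> = stage k m n (Suc i) (kres k m p \<phi>) z"
    by (simp add: stage_def R_def w_def w'_def v_def y_def)
  finally show ?thesis .
qed

text \<open>Poles of the second kind iterate \<open>r \<mapsto> 1 / (2 - r)\<close>, which sends
  \<open>c / (c + 1)\<close> to \<open>(c + 1) / (c + 2)\<close>; so \<open>r\<close> is determined
  by the counter \<open>c\<close> of \<open>branch\<close>.\<close>

lemma iter_residue_stage:
  assumes "\<And>z. generic n i z \<Longrightarrow> G z = stage k m n i \<phi> z" "\<phi> meromorphic_on UNIV"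
    and k: "k = 2 * m + 1" "m > 0"
  shows "iter_residue n i (of_nat c / of_nat (Suc c)) G z = branch k m n c \<phi>"
  using assms(1,2)
proof (induction n arbitrary: i c G \<phi> z)
  case 0
  have "residue (\<lambda>t. G (z(i := t))) 0 = residue (\<lambda>t. \<phi> 0 / t) 0"
  proof (rule residue_cong)
    have "\<forall>\<^sub>F t in at (0 :: complex). t \<noteq> 0" by (rule eventually_neq_at_within)
    then show "\<forall>\<^sub>F t in at 0. G (z(i := t)) = \<phi> 0 / t"
    proof eventually_elim
      case (elim t)
      have "G (z(i := t)) = stage k m 0 i \<phi> (z(i := t))"
        using elim by (intro 0) (auto simp: generic_def)
      also have "\<dots> = t ^ (m - 1 + Suc m) / t ^ k * \<phi> 0"
        by (simp add: stage_def power_add)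
      \<comment> \<open>The insertion \<open>z ^ (m - 1)\<close> and the factor
        \<open>z ^ (m + 1)\<close> of \<open>stage\<close> make up \<open>z ^ (k - 1)\<close>, so a
        simple pole remains.\<close>
      also have "k = Suc (m - 1 + Suc m)" using k by simp
      also have "t ^ (m - 1 + Suc m) / t ^ Suc (m - 1 + Suc m) = 1 / t"
        using elim by (simp del: power_Suc add: power_Suc2)
      finally show ?case by (simp only: times_divide_eq_left mult_1)
    qed
  qed simp
  also have "\<dots> = \<phi> 0"
    using residue_simple[of UNIV 0 "\<lambda>_. \<phi> 0"] by simp
  finally show ?case by (simp add: residue_var_def)
next
  case (Suc n)
  have k0: "k > 0" using k by simp
  let ?r = "of_nat c / of_nat (Suc c) :: complex"
  have r: "2 - ?r = of_nat (Suc (Suc c)) / of_nat (Suc c)"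
    by (simp add: field_simps del: of_nat_Suc) (simp add: algebra_simps)
  then have r': "1 / (2 - ?r) = of_nat (Suc c) / of_nat (Suc (Suc c))" by simp
  have neq: "- of_nat (Suc c) \<noteq> (1 :: complex)" by (simp add: complex_eq_iff)
  have "iter_residue n (Suc i) 0 (residue_var i (\<lambda>_. 0) G) z = branch k m n 0 (kres k m 0 \<phi>)"
    using Suc.IH[of "Suc i" "residue_var i (\<lambda>_. 0) G" "kres k m 0 \<phi>" 0 z]
      residue_var_stage[OF Suc.prems, of 0 _ "\<lambda>_. 0"] k0 kres_meromorphic[OF Suc.prems(2)] by simp
  moreover have "iter_residue n (Suc i) (of_nat (Suc c) / of_nat (Suc (Suc c)))
      (residue_var i (\<lambda>z. z (Suc i) / (2 - ?r)) G) z = branch k m n (Suc c) (kres k m (- of_nat (Suc c)) \<phi>)"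
  proof (rule Suc.IH)
    fix z assume gen: "generic n (Suc i) z"
    have "- of_nat (Suc c) / (- of_nat (Suc c) - 1) = of_nat (Suc c) / (of_nat (Suc (Suc c)) :: complex)"
    proof -
      have "- of_nat (Suc c) - 1 = - (of_nat (Suc (Suc c)) :: complex)" by simp
      then show ?thesis by (simp only: minus_divide_divide)
    qed
    then show "residue_var i (\<lambda>z. z (Suc i) / (2 - ?r)) G z = stage k m n (Suc i) (kres k m (- of_nat (Suc c)) \<phi>) z"
      by (intro residue_var_stage Suc.prems neq k0 gen) (simp_all add: r del: of_nat_Suc)
  qed (rule kres_meromorphic[OF Suc.prems(2)])
  ultimately show ?case unfolding iter_residue.simps r' by simp
qed

lemma chain_rest_eq:
  "chain_rest k m n i z = (\<Prod>l=i..i+n. 1 / z l ^ k) * (\<Prod>l=Suc i..i+n. e_edge k (z (l - 1)) (z l)) *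
    (if n = 0 then 1 else 1 / (of_nat k * z i)) *
    (\<Prod>l=Suc i..<i+n. 1 / (of_nat k * z l * (2 * z l - z (l - 1) - z (l + 1)))) * z (i + n) ^ (m - 1)"
proof (induction n arbitrary: i)
  case (Suc n)
  have 1: "(\<Prod>l=i..i + Suc n. 1 / z l ^ k) = 1 / z i ^ k * (\<Prod>l=Suc i..Suc i + n. 1 / z l ^ k)"
    by (simp add: prod.atLeast_Suc_atMost)
  have 2: "(\<Prod>l=Suc i..i + Suc n. e_edge k (z (l - 1)) (z l)) =
      e_edge k (z i) (z (Suc i)) * (\<Prod>l=Suc (Suc i)..Suc i + n. e_edge k (z (l - 1)) (z l))"
    by (simp add: prod.atLeast_Suc_atMost)
  have 3: "(\<Prod>l=Suc i..<i + Suc n. 1 / (of_nat k * z l * (2 * z l - z (l - 1) - z (l + 1)))) =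
      (if n = 0 then 1 else 1 / (of_nat k * z (Suc i) * (2 * z (Suc i) - z i - z (Suc (Suc i))))) *
      (\<Prod>l=Suc (Suc i)..<Suc i + n. 1 / (of_nat k * z l * (2 * z l - z (l - 1) - z (l + 1))))"
    by (cases n) (simp_all add: prod.atLeast_Suc_lessThan del: prod.op_ivl_Suc)
  show ?case
    unfolding chain_rest.simps Suc.IH 1 2 3 by (cases "n = 0") (simp_all add: mult_ac)
qed simp

text \<open>All factors are linear in \<open>z\<close>: there are \<open>k d - m\<close> of them
  above and \<open>k (d - 1)\<close> below, which leaves degree \<open>m + 1\<close>.\<close>

lemma f_disk_homogeneous:
  assumes k: "k = 2 * m + 1" "m > 0" and d: "d > 0"
  shows "f_disk k k d z = f_disk k k d 1 * z ^ Suc m"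
proof (cases "z = 0")
  case True
  have "(\<Prod>j=0..k * d - (k + 1) div 2.
      (of_nat j * (- z) + (of_nat (k * (2 * d - 1)) - of_nat j) * z) / of_nat (2 * d - 1)) = 0"
    using True by simp
  then show ?thesis using True by (simp add: f_disk_def)
next
  case False
  have *: "(of_nat j * (- z) + (c - of_nat j) * z) / e = (of_nat j * (- 1) + (c - of_nat j) * 1) / e * z" for j c e
    by (simp add: divide_simps) (simp add: algebra_simps)?
  have e: "Suc (k * d - (k + 1) div 2) = (d - 1) * k + Suc m"
    using k d by (cases d) (auto simp: algebra_simps)
  have "f_disk k k d z = 2 / of_nat (2 * d - 1) *
     ((\<Prod>j=0..k * d - (k + 1) div 2.
         (of_nat j * (- 1) + (of_nat (k * (2 * d - 1)) - of_nat j) * 1) / of_nat (2 * d - 1)) * z ^ Suc (k * d - (k + 1) div 2) /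
      ((\<Prod>j=1..d - 1.
         (of_nat j * (- 1) + (of_nat (2 * d - 1) - of_nat j) * 1) / of_nat (2 * d - 1)) * z ^ (d - 1)) ^ k)"
    unfolding f_disk_def *[of _ "of_nat (k * (2 * d - 1))"] *[of _ "of_nat (2 * d - 1)"] prod.distrib by simp
  also have "\<dots> = f_disk k k d 1 * z ^ Suc m"
    unfolding e f_disk_def power_mult_distrib power_add power_mult[symmetric] using False by simp
  finally show ?thesis .
qed

text \<open>The contribution of \<open>f_disk\<close> and of the special denominator of
  \<open>z 0\<close>, in the coordinate \<open>t\<close>. The value at 0 is
  \<open>f_disk k k d 1\<close>, as the chain with \<open>j = 0\<close> requires.\<close>

definition disk_start :: "nat \<Rightarrow> nat \<Rightarrow> complex \<Rightarrow> complex" where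
  "disk_start k d t = (of_nat d - 1 / 2) * f_disk k k d 1 / (of_nat d - 1 / 2 + t)"

lemma half_odd_neq_0: "d > 0 \<Longrightarrow> of_nat d - 1 / 2 \<noteq> (0 :: complex)"
  by (simp add: complex_eq_iff)

lemma disk_integrand_eq_stage:
  assumes k: "k = 2 * m + 1" "m > 0" and d: "j < d" and z: "generic j 0 z"
  shows "disk_integrand k k (m - 1) d j z = stage k m j 0 (disk_start k (d - j)) z"
proof (cases "j = 0")
  case True
  then show ?thesis
    using half_odd_neq_0[of d] d
    by (simp add: disk_integrand_def stage_def disk_start_def f_disk_homogeneous[OF k, of d "z 0"])
next
  case False
  define n where "n = of_nat (d - j) - (1 / 2 :: complex)"
  define f where "f = f_disk k k (d - j) 1"
  have n0: "n \<noteq> 0" unfolding n_def using half_odd_neq_0[of "d - j"] d by simp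
  have n: "of_nat (2 * (d - j) - 1) = 2 * n"
    using d by (simp add: n_def of_nat_diff)
  have z01: "z 0 \<noteq> 0" "z 0 - z 1 \<noteq> 0" using z False by (auto simp: generic_def)
  have fd: "f_disk k k (d - j) (z 0) = f * z 0 ^ Suc m"
    unfolding f_def by (rule f_disk_homogeneous[OF k]) (use d in simp)
  have set: "{1..j - 1} = {Suc 0..<0 + j}" "{1..j} = {Suc 0..0 + j}" "{0..j} = {0..0 + j}" using False by auto
  have den: "2 / (2 * n) * z 0 + z 0 - z 1 = (n + z 0 / (z 0 - z 1)) * (z 0 - z 1) / n"
    using n0 z01 by (simp add: field_simps)
  have "disk_integrand k k (m - 1) d j z =
      chain_rest k m j 0 z * (f * z 0 ^ Suc m) * (n / ((n + z 0 / (z 0 - z 1)) * (z 0 - z 1)))"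
    unfolding disk_integrand_def chain_rest_eq fd n den set using False by simp
  also have "\<dots> = stage k m j 0 (disk_start k (d - j)) z"
    using False by (simp add: stage_def disk_start_def n_def f_def)
  finally show ?thesis .
qed

lemma disk_start_meromorphic: "disk_start k d meromorphic_on A"
  unfolding disk_start_def by (intro meromorphic_intros)

lemma half_odd_neq_nat: "of_nat d - 1 / 2 \<noteq> (of_nat p :: complex)"
proof
  assume "of_nat d - 1 / 2 = (of_nat p :: complex)"
  then have "Re (of_nat d - 1 / 2) = Re (of_nat p)" by simp
  then have "2 * real d - 1 = 2 * real p" by simp
  then have "real (2 * d) = real (2 * p + 1)" by simp
  then have "2 * d = 2 * p + 1" by (simp only: of_nat_eq_iff)
  then show False by presburger
qed

lemma disk_start_analytic: "disk_start k d analytic_on {- of_nat p}"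
  unfolding disk_start_def using half_odd_neq_nat[of d p] by (intro analytic_intros) auto

lemma disk_term_eq_ktot:
  assumes k: "k = 2 * m + 1" "m > 0" and d: "j < d" and M: "j \<le> M"
  shows "disk_term k k (m - 1) d j = (ktot k m M ^^ j) (disk_start k (d - j)) 0"
proof -
  define \<phi> where "\<phi> = disk_start k (d - j)"
  have k0: "k > 0" using k by simp
  have mero: "\<phi> meromorphic_on UNIV" unfolding \<phi>_def by (rule disk_start_meromorphic)
  have G: "generic j 0 z \<Longrightarrow> disk_integrand k k (m - 1) d j z = stage k m j 0 \<phi> z" for z
    unfolding \<phi>_def by (rule disk_integrand_eq_stage[OF k d])
  show ?thesis
  proof (cases j)
    case 0
    have "iter_residue 0 0 (of_nat 0 / of_nat (Suc 0)) (disk_integrand k k (m - 1) d j) (\<lambda>_. 0) = branch k m 0 0 \<phi>"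
      by (rule iter_residue_stage[OF _ mero k]) (use G 0 in simp)
    then show ?thesis by (simp add: disk_term_def 0 \<phi>_def)
  next
    case (Suc n)
    let ?g = "kres k m 0 \<phi>"
    have g: "?g meromorphic_on UNIV" by (rule kres_meromorphic[OF mero])
    have "iter_residue n 1 (of_nat 0 / of_nat (Suc 0)) (residue_var 0 (\<lambda>_. 0) (disk_integrand k k (m - 1) d j)) (\<lambda>_. 0)
        = branch k m n 0 ?g"
    proof (rule iter_residue_stage[OF _ g k])
      fix z assume "generic n 1 z"
      then show "residue_var 0 (\<lambda>_. 0) (disk_integrand k k (m - 1) d j) z = stage k m n 1 ?g z"
        using residue_var_stage[of n 0 "disk_integrand k k (m - 1) d j" k m \<phi> 0 z "\<lambda>_. 0"] G mero k0 Suc by simp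
    qed
    then have "disk_term k k (m - 1) d j = branch k m n 0 ?g"
      by (simp add: disk_term_def Suc)
    also have "\<dots> = (ktot k m M ^^ n) ?g 0"
    proof (rule branch_eq_ktot[OF g])
      fix p :: nat assume p: "p \<noteq> Suc 0" "p \<noteq> 0"
      then have "- of_nat p \<noteq> (0 - 1 :: complex)"
        by (simp add: complex_eq_iff)
      then show "?g analytic_on {- of_nat p}"
        by (rule kres_analytic[OF mero])
    qed (use M Suc in simp)
    also have "\<dots> = (ktot k m M ^^ n) (ktot k m M \<phi>) 0"
    proof (rule agree_at_0[OF ktot_pow_cong])
      have "agree (ktot k m M \<phi>) (\<lambda>y. ?g y + kres k m (- of_nat (Suc 0)) \<phi> y)"
        by (rule agree_ktot_branch) (use disk_start_analytic \<phi>_def M Suc in auto)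
      \<comment> \<open>For \<open>z 0\<close> only the residue at 0 is prescribed; the others may
        be added because the pole of \<open>disk_start\<close> is not an integer.\<close>
      moreover have "kres k m (- of_nat (Suc 0)) \<phi> y = 0" if "2 * y \<notin> \<int> \<or> y = 0" for y
        using that disk_start_analytic[of k "d - j" 1] half_int_or_0_neq[of y "Suc 0"] unfolding \<phi>_def
        by (intro kres_eq_0) (auto simp: complex_eq_iff)
      ultimately show "agree ?g (ktot k m M \<phi>)"
        by (simp add: agree_def)
    qed
    also have "\<dots> = (ktot k m M ^^ j) \<phi> 0"
      by (simp add: Suc funpow_swap1)
    finally show ?thesis by (simp add: \<phi>_def)
  qed
qed

lemma w_disk_eq_ktot:
  assumes k: "k = 2 * m + 1" "m > 0" and d: "d > 0"
  shows "w_disk k k (m - 1) d = (\<Sum>j=0..d-1. (ktot k m d ^^ j) (disk_start k (d - j)) 0)"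
  unfolding w_disk_def by (intro sum.cong refl disk_term_eq_ktot k) (use d in auto)

section \<open>Nested derivatives\<close>

text \<open>\<open>exp (-y x) d/dx exp (y x)\<close>, where the variable of the series is \<open>q = exp x\<close>.\<close>

definition twisted_deriv :: "'a :: comm_ring_1 \<Rightarrow> 'a fps \<Rightarrow> 'a fps" where
  "twisted_deriv y f = Abs_fps (\<lambda>n. (of_nat n + y) * fps_nth f n)"

text \<open>\<open>nested\<close> with the factor \<open>exp (y x)\<close> taken out. The ring is
  left open because \<open>y\<close> is sometimes a complex number and sometimes the formal variable
  \<open>fps_X\<close>.\<close>

primrec nest :: "'a :: comm_ring_1 \<Rightarrow> (nat \<Rightarrow> 'a fps) \<Rightarrow> 'a fps \<Rightarrow> nat \<Rightarrow> 'a fps" where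
  "nest y M g 0 = M 0 * g"
| "nest y M g (Suc p) = M (Suc p) * twisted_deriv y (nest y M g p)"

section \<open>Series in \<open>q = exp x\<close> inside the series in
  \<open>exp (x / 2)\<close>\<close>

definition spread :: "complex poly fps \<Rightarrow> exp_series" where
  "spread F = Abs_fps (\<lambda>n. if even n then fps_nth F (n div 2) else 0)"

definition const_coeffs :: "complex fps \<Rightarrow> complex poly fps" where
  "const_coeffs f = Abs_fps (\<lambda>n. [:fps_nth f n:])"

definition q_series :: "complex fps \<Rightarrow> exp_series" where
  "q_series f = spread (const_coeffs f)"

definition const_in_y :: "complex fps \<Rightarrow> complex fps fps" where
  "const_in_y f = Abs_fps (\<lambda>n. fps_const (fps_nth f n))"

text \<open>The coefficient of \<open>y\<^sup>j\<close> in \<open>exp (y x) a(y)\<close>.\<close>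

definition exp_coeff :: "nat \<Rightarrow> complex fps \<Rightarrow> complex poly" where
  "exp_coeff j a = fps_nth (Abs_fps (\<lambda>i. [:fps_nth a i:]) * exp_yx) j"

definition y_coeff :: "nat \<Rightarrow> complex fps fps \<Rightarrow> exp_series" where
  "y_coeff j A = spread (Abs_fps (\<lambda>b. exp_coeff j (fps_nth A b)))"

lemma spread_nth: "fps_nth (spread F) n = (if even n then fps_nth F (n div 2) else 0)"
  by (simp add: spread_def)

lemma spread_mult: "spread (F * G) = spread F * spread G"
proof (rule fps_ext)
  fix n
  show "fps_nth (spread (F * G)) n = fps_nth (spread F * spread G) n"
  proof (cases "even n")
    case True
    then obtain b where n: "n = 2 * b" by auto
    have "fps_nth (spread F * spread G) n =
        (\<Sum>i\<in>(\<lambda>i. 2 * i) ` {0..b}. fps_nth (spread F) i * fps_nth (spread G) (n - i))"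
      unfolding fps_mult_nth
    proof (rule sum.mono_neutral_right)
      show "\<forall>i\<in>{0..n} - (\<lambda>i. 2 * i) ` {0..b}. fps_nth (spread F) i * fps_nth (spread G) (n - i) = 0"
      proof
        fix i assume i: "i \<in> {0..n} - (\<lambda>i. 2 * i) ` {0..b}"
        then have "odd i" by (auto simp: n elim!: evenE)
        then show "fps_nth (spread F) i * fps_nth (spread G) (n - i) = 0" by (simp add: spread_nth)
      qed
    qed (auto simp: n)
    also have "\<dots> = (\<Sum>i=0..b. fps_nth F i * fps_nth G (b - i))"
      by (subst sum.reindex)
        (auto simp: inj_on_def spread_nth n simp flip: diff_mult_distrib2 intro!: sum.cong)
    finally show ?thesis by (simp add: spread_nth n fps_mult_nth)
  next
    case False
    then have "fps_nth (spread F * spread G) n = 0"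
      unfolding fps_mult_nth by (intro sum.neutral) (auto simp: spread_nth)
    then show ?thesis using False by (simp add: spread_nth)
  qed
qed

lemma const_coeffs_mult: "const_coeffs (f * g) = const_coeffs f * const_coeffs g"
proof (rule fps_ext)
  fix n
  have *: "[:sum h A:] = (\<Sum>i\<in>A. [:h i:])" for h :: "nat \<Rightarrow> complex" and A
    by (simp add: poly_eq_iff coeff_sum coeff_pCons split: nat.split)
  show "fps_nth (const_coeffs (f * g)) n = fps_nth (const_coeffs f * const_coeffs g) n"
    by (simp add: const_coeffs_def fps_mult_nth * mult.commute)
qed

lemma q_series_mult: "q_series (f * g) = q_series f * q_series g"
  by (simp add: q_series_def const_coeffs_mult spread_mult)

lemma q_series_nth: "fps_nth (q_series f) n = (if even n then [:fps_nth f (n div 2):] else 0)"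
  by (simp add: q_series_def spread_nth const_coeffs_def)

lemma q_series_1: "q_series 1 = 1"
  by (rule fps_ext) (auto simp: q_series_nth)

lemma recip_q_series:
  assumes "fps_nth f 0 = 1"
  shows "recip (q_series f) = q_series (inverse f)"
proof -
  have "q_series f * recip (q_series f) = 1"
    by (rule recip_right_inverse) (simp add: q_series_nth assms)
  moreover have "q_series f * q_series (inverse f) = 1"
    using assms by (simp add: inverse_mult_eq_1' q_series_1 flip: q_series_mult)
  ultimately show ?thesis
    by (metis mult.left_commute mult.right_neutral)
qed

lemma smult_sum_distrib: "smult c (\<Sum>i\<in>A. f i) = (\<Sum>i\<in>A. smult c (f i))"
  by (induction A rule: infinite_finite_induct) (simp_all add: smult_add_right)

lemma pderiv_sum_distrib: "pderiv (\<Sum>i\<in>A. f i) = (\<Sum>i\<in>A. pderiv (f i))"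
  by (induction A rule: infinite_finite_induct) (simp_all add: pderiv_add)

lemma exp_coeff_sum: "exp_coeff j a = (\<Sum>i=0..j. smult (fps_nth a i) (monom (1 / fact (j - i)) (j - i)))"
  by (simp add: exp_coeff_def fps_mult_nth exp_yx_def)

lemma exp_coeff_linear: "exp_coeff j (\<Sum>i\<in>A. fps_const (c i) * a i) = (\<Sum>i\<in>A. [:c i:] * exp_coeff j (a i))"
proof -
  have add: "exp_coeff j (a + b) = exp_coeff j a + exp_coeff j b" for a b
    by (simp add: exp_coeff_sum sum.distrib smult_add_left)
  have cmult: "exp_coeff j (fps_const c * a) = [:c:] * exp_coeff j a" for a c
    by (simp add: exp_coeff_sum smult_sum_distrib)
  have zero: "exp_coeff j 0 = 0"
    by (simp add: exp_coeff_sum)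
  show ?thesis
    by (induction A rule: infinite_finite_induct) (simp_all add: add cmult zero)
qed

lemma y_coeff_mult: "y_coeff j (const_in_y f * A) = q_series f * y_coeff j A"
proof -
  have "Abs_fps (\<lambda>b. exp_coeff j (fps_nth (const_in_y f * A) b)) =
      const_coeffs f * Abs_fps (\<lambda>b. exp_coeff j (fps_nth A b))"
  proof (rule fps_ext)
    fix n
    have "exp_coeff j (\<Sum>i=0..n. fps_const (fps_nth f i) * fps_nth A (n - i)) =
        (\<Sum>i=0..n. [:fps_nth f i:] * exp_coeff j (fps_nth A (n - i)))"
      by (rule exp_coeff_linear)
    then show "fps_nth (Abs_fps (\<lambda>b. exp_coeff j (fps_nth (const_in_y f * A) b))) n =
        fps_nth (const_coeffs f * Abs_fps (\<lambda>b. exp_coeff j (fps_nth A b))) n"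
      by (simp add: fps_mult_nth const_in_y_def const_coeffs_def)
  qed
  then show ?thesis by (simp add: y_coeff_def q_series_def spread_mult)
qed

text \<open>Differentiating \<open>exp (y x)\<close> in \<open>x\<close> multiplies it by
  \<open>y\<close>.\<close>

lemma pderiv_exp_coeff: "pderiv (exp_coeff j a) = exp_coeff j (fps_X * a)"
proof (cases j)
  case 0
  then show ?thesis by (simp add: exp_coeff_sum pderiv_pCons)
next
  case (Suc l)
  have *: "(\<Sum>i=0..Suc l. smult (fps_nth (fps_X * a) i) (monom (1 / fact (Suc l - i)) (Suc l - i))) =
      (\<Sum>i=0..l. smult (fps_nth a i) (monom (1 / fact (l - i)) (l - i)))"
    by (subst sum.atLeast0_atMost_Suc_shift) simp
  have "pderiv (\<Sum>i=0..Suc l. smult (fps_nth a i) (monom (1 / fact (Suc l - i)) (Suc l - i))) =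
      (\<Sum>i=0..Suc l. smult (fps_nth a i) (pderiv (monom (1 / fact (Suc l - i)) (Suc l - i))))"
    by (simp only: pderiv_sum_distrib pderiv_smult)
  also have "\<dots> = (\<Sum>i=0..l. smult (fps_nth a i) (pderiv (monom (1 / fact (Suc l - i)) (Suc l - i))))"
    by (simp add: pderiv_monom)
  also have "\<dots> = (\<Sum>i=0..l. smult (fps_nth a i) (monom (1 / fact (l - i)) (l - i)))"
  proof (intro sum.cong refl)
    fix i assume "i \<in> {0..l}"
    then have e: "Suc l - i = Suc (l - i)" by auto
    have "1 / fact (Suc (l - i)) * of_nat (Suc (l - i)) = (1 / fact (l - i) :: complex)"
      by (simp add: field_simps del: of_nat_Suc)
    then show "smult (fps_nth a i) (pderiv (monom (1 / fact (Suc l - i)) (Suc l - i))) =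
        smult (fps_nth a i) (monom (1 / fact (l - i)) (l - i))"
      unfolding e pderiv_monom by (simp add: mult.commute del: of_nat_Suc fact_Suc)
  qed
  finally show ?thesis unfolding exp_coeff_sum Suc * .
qed

lemma ddx_y_coeff: "ddx (y_coeff j A) = y_coeff j (twisted_deriv fps_X A)"
proof (rule fps_ext)
  fix n
  have "exp_coeff j ((of_nat b + fps_X) * a) = pderiv (exp_coeff j a) + smult (of_nat b) (exp_coeff j a)" for a b
  proof -
    have "exp_coeff j ((of_nat b + fps_X) * a) =
        exp_coeff j (\<Sum>i\<in>{0::nat, 1}. fps_const (if i = 0 then of_nat b else 1) * (if i = 0 then a else fps_X * a))"
      by (simp add: distrib_right fps_of_nat)
    then show ?thesis unfolding exp_coeff_linear by (simp add: pderiv_exp_coeff)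
  qed
  then show "fps_nth (ddx (y_coeff j A)) n = fps_nth (y_coeff j (twisted_deriv fps_X A)) n"
    by (auto simp: ddx_def y_coeff_def spread_nth twisted_deriv_def elim!: evenE)
qed

lemma w_deriv_eq_y_coeff: "w_deriv k j = y_coeff j (Abs_fps (w_ratio k))"
proof (rule fps_ext)
  fix n
  have "fps_nth ((fps_deriv ^^ j) f) 0 = smult (fact j) (fps_nth f j)" for f :: "complex poly fps"
  proof -
    have "fact j = [:fact j :: complex:]"
      using of_nat_poly[of "fact j", where 'a = complex] by simp
    then show ?thesis by (simp add: fps_0th_higher_deriv)
  qed
  then show "fps_nth (w_deriv k j) n = fps_nth (y_coeff j (Abs_fps (w_ratio k))) n"
    by (simp add: w_deriv_def w_series_def y_coeff_def spread_nth exp_coeff_def)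
qed

text \<open>Reads off the constant terms in even degrees; that there is nothing else is part of
  \<open>Lt_structure\<close>.\<close>

definition L_series :: "nat \<Rightarrow> nat \<Rightarrow> complex fps" where
  "L_series k i = Abs_fps (\<lambda>d. coeff (fps_nth (Lt k i) (2 * d)) 0)"

definition L_inv :: "nat \<Rightarrow> nat \<Rightarrow> complex fps" where
  "L_inv k i = inverse (L_series k i)"

abbreviation formal_nest :: "nat \<Rightarrow> nat \<Rightarrow> complex fps fps" where
  "formal_nest k \<equiv> nest fps_X (\<lambda>i. const_in_y (L_inv k i)) (Abs_fps (w_ratio k))"

text \<open>Against coefficients of order at least \<open>j\<close> in \<open>y\<close>, only the
  constant term of \<open>exp (y x)\<close> contributes to \<open>y ^ j\<close>, so no power of
  \<open>x\<close> remains.\<close>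

lemma y_coeff_leading:
  assumes "\<And>b i. i < j \<Longrightarrow> fps_nth (fps_nth A b) i = 0"
  shows "y_coeff j A = q_series (Abs_fps (\<lambda>b. fps_nth (fps_nth A b) j))"
proof (rule fps_ext)
  fix n
  have "exp_coeff j (fps_nth A b) = [:fps_nth (fps_nth A b) j:]" for b
  proof -
    have "exp_coeff j (fps_nth A b) = (\<Sum>i\<in>{j}. smult (fps_nth (fps_nth A b) i) (monom (1 / fact (j - i)) (j - i)))"
      unfolding exp_coeff_sum by (rule sum.mono_neutral_right) (auto simp: assms)
    then show ?thesis by (simp add: monom_0)
  qed
  then show "fps_nth (y_coeff j A) n = fps_nth (q_series (Abs_fps (\<lambda>b. fps_nth (fps_nth A b) j))) n"
    by (simp add: y_coeff_def spread_nth q_series_nth)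
qed

lemma const_in_y_mult_nth:
  "fps_nth (fps_nth (const_in_y f * A) b) j = (\<Sum>i=0..b. fps_nth f i * fps_nth (fps_nth A (b - i)) j)"
  unfolding fps_mult_nth[of "const_in_y f" A] by (simp add: const_in_y_def fps_sum_nth)

lemma L_series_eqI: "Lt k i = q_series f \<Longrightarrow> L_series k i = f"
  by (rule fps_ext) (simp add: L_series_def q_series_nth)

lemma twisted_deriv_X_nth:
  "fps_nth (fps_nth (twisted_deriv fps_X A) b) j =
    of_nat b * fps_nth (fps_nth A b) j + (if j = 0 then 0 else fps_nth (fps_nth A b) (j - 1))"
  by (simp add: twisted_deriv_def distrib_right fps_of_nat[symmetric])

text \<open>The claims need each other. By definition \<open>Lt k (p + 1)\<close> comes from the
  coefficient of \<open>y ^ (p + 1)\<close> in the derivative of \<open>N\<^sub>p\<close>, whose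
  lower coefficients vanish; hence it is free of \<open>x\<close>, and division by it normalises the
  leading coefficient of \<open>N\<^sub>p\<^sub>+\<^sub>1\<close> to 1.\<close>

lemma Lt_structure:
  "Lt k p = q_series (L_series k p) \<and> fps_nth (L_series k p) 0 = 1 \<and>
   (\<forall>j. nested (Lt k) (w_deriv k j) p = y_coeff j (formal_nest k p)) \<and>
   (\<forall>b. (\<forall>j<p. fps_nth (fps_nth (formal_nest k p) b) j = 0) \<and>
        fps_nth (fps_nth (formal_nest k p) b) p = (if b = 0 then 1 else 0))"
proof (induction p)
  case 0
  define f where "f = Abs_fps (\<lambda>b. fps_nth (w_ratio k b) 0)"
  have Lt: "Lt k 0 = q_series f"
    by (simp add: w_deriv_eq_y_coeff y_coeff_leading f_def)
  then have L: "L_series k 0 = f" by (rule L_series_eqI)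
  have f0: "fps_nth f 0 = 1" by (simp add: f_def w_ratio_def)
  have "fps_nth (fps_nth (formal_nest k 0) b) 0 = fps_nth (L_inv k 0 * f) b" for b
    unfolding nest.simps const_in_y_mult_nth fps_mult_nth[of "L_inv k 0" f] by (simp add: f_def)
  moreover have "L_inv k 0 * f = 1"
    unfolding L_inv_def L using f0 by (simp add: inverse_mult_eq_1)
  moreover have "nested (Lt k) (w_deriv k j) 0 = y_coeff j (formal_nest k 0)" for j
    unfolding nested.simps Lt recip_q_series[OF f0] w_deriv_eq_y_coeff nest.simps y_coeff_mult L_inv_def L ..
  ultimately show ?case using Lt L f0 by simp
next
  case (Suc p)
  let ?N = "formal_nest k p"
  define f where "f = Abs_fps (\<lambda>b. fps_nth (fps_nth (twisted_deriv fps_X ?N) b) (Suc p))"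
  \<comment> \<open>For \<open>j = p\<close> the derivative multiplies the leading coefficient by
    \<open>b\<close>, and that coefficient is 0 unless \<open>b = 0\<close>.\<close>
  have low: "fps_nth (fps_nth (twisted_deriv fps_X ?N) b) j = 0" if "j < Suc p" for b j
    using Suc.IH that unfolding twisted_deriv_X_nth by (cases "j = p") auto
  have "Lt k (Suc p) = ddx (nested (Lt k) (w_deriv k (Suc p)) p)" by simp
  also have "\<dots> = y_coeff (Suc p) (twisted_deriv fps_X ?N)"
    using Suc.IH by (simp add: ddx_y_coeff)
  also have "\<dots> = q_series f"
    unfolding f_def by (rule y_coeff_leading) (rule low)
  finally have Lt: "Lt k (Suc p) = q_series f" .
  then have L: "L_series k (Suc p) = f" by (rule L_series_eqI)
  have f0: "fps_nth f 0 = 1" using Suc.IH by (simp add: f_def twisted_deriv_X_nth)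
  have "fps_nth (fps_nth (formal_nest k (Suc p)) b) (Suc p) = fps_nth (L_inv k (Suc p) * f) b" for b
    unfolding nest.simps const_in_y_mult_nth fps_mult_nth[of "L_inv k (Suc p)" f] by (simp add: f_def)
  moreover have "L_inv k (Suc p) * f = 1"
    unfolding L_inv_def L using f0 by (simp add: inverse_mult_eq_1)
  moreover have "nested (Lt k) (w_deriv k j) (Suc p) = y_coeff j (formal_nest k (Suc p))" for j
    using Suc.IH unfolding nested.simps Lt recip_q_series[OF f0] nest.simps y_coeff_mult L_inv_def L
    by (simp add: ddx_y_coeff)
  moreover have "fps_nth (fps_nth (formal_nest k (Suc p)) b) j = 0" if "j < Suc p" for b j
    using low[OF that] by (simp add: const_in_y_mult_nth)
  ultimately show ?case using Lt L f0 by simp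
qed

text \<open>
  Continues \<open>nest y M g m\<close> with \<open>M (m - 1), \<dots>, M 0\<close>. The operator \<open>g \<mapsto> conest y M g m m\<close> is palindromic,
  hence formally self-adjoint.
\<close>

primrec conest :: "'a :: comm_ring_1 \<Rightarrow> (nat \<Rightarrow> 'a fps) \<Rightarrow> 'a fps \<Rightarrow> nat \<Rightarrow> nat \<Rightarrow> 'a fps" where
  "conest y M g m 0 = nest y M g m"
| "conest y M g m (Suc i) = M (m - Suc i) * twisted_deriv y (conest y M g m i)"

text \<open>Integration by parts: since \<open>y + y' + N = 0\<close>, coefficients of
  \<open>q ^ N\<close> are constant terms of products of \<open>exp (y x) f\<close> and
  \<open>exp (y' x) g\<close>, and a derivative has constant term 0.\<close>

lemma twisted_deriv_adjoint:
  fixes f g :: "'a :: comm_ring_1 fps"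
  assumes "y' = - y - of_nat N"
  shows "fps_nth (f * twisted_deriv y' g) N = - fps_nth (twisted_deriv y f * g) N"
  unfolding fps_mult_nth sum_negf[symmetric]
proof (intro sum.cong refl)
  fix i assume "i \<in> {0..N}"
  then have "of_nat N = (of_nat i + of_nat (N - i) :: 'a)" by (simp flip: of_nat_add)
  then have "of_nat (N - i) + y' = - (of_nat i + y)" by (simp add: assms)
  then show "fps_nth f i * fps_nth (twisted_deriv y' g) (N - i) = - (fps_nth (twisted_deriv y f) i * fps_nth g (N - i))"
    by (simp only: twisted_deriv_def fps_nth_Abs_fps) (simp add: algebra_simps)
qed

lemma conest_adjoint_step:
  assumes y': "y' = - y - of_nat N" and "i < m"
  shows "fps_nth (conest y M g m 0 * twisted_deriv y' (nest y' M g' (m - 1))) N =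
    (-1) ^ i * fps_nth (conest y M g m i * twisted_deriv y' (nest y' M g' (m - 1 - i))) N"
  using assms(2)
proof (induction i)
  case (Suc i)
  have e: "m - 1 - i = Suc (m - 1 - Suc i)" "m - Suc i = Suc (m - 1 - Suc i)" using Suc.prems by auto
  have "fps_nth (conest y M g m i * twisted_deriv y' (nest y' M g' (m - 1 - i))) N =
      - fps_nth (twisted_deriv y (conest y M g m i) * nest y' M g' (m - 1 - i)) N"
    by (rule twisted_deriv_adjoint[OF y'])
  also have "twisted_deriv y (conest y M g m i) * nest y' M g' (m - 1 - i) =
      conest y M g m (Suc i) * twisted_deriv y' (nest y' M g' (m - 1 - Suc i))"
    unfolding e(1) by (simp add: e(2) mult_ac)
  finally show ?case using Suc by simp
qed simp

text \<open>Integration by parts, \<open>m\<close> times, moves every derivative and every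
  \<open>M i\<close> to the left factor.\<close>

lemma conest_adjoint:
  assumes y': "y' = - y - of_nat N" and "m > 0"
  shows "fps_nth (nest y M g m * twisted_deriv y' (nest y' M g' (m - 1))) N =
    (-1) ^ m * fps_nth (conest y M g m m * g') N"
proof -
  obtain l where l: "m = Suc l" using assms(2) by (cases m) auto
  have "fps_nth (nest y M g m * twisted_deriv y' (nest y' M g' (m - 1))) N =
      (-1) ^ l * fps_nth (conest y M g m l * twisted_deriv y' (nest y' M g' 0)) N"
    using conest_adjoint_step[OF y', of l m M g g'] l by simp
  also have "\<dots> = (-1) ^ m * fps_nth (twisted_deriv y (conest y M g m l) * nest y' M g' 0) N"
    by (subst twisted_deriv_adjoint[OF y']) (simp add: l)
  also have "twisted_deriv y (conest y M g m l) * nest y' M g' 0 = conest y M g m m * g'"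
    by (simp add: l mult_ac)
  finally show ?thesis .
qed

text \<open>Up to the same sign, both sides equal the pairing in which \<open>M m\<close> stands
  between two chains of \<open>m\<close> derivatives, and this pairing is symmetric.\<close>

lemma conest_self_adjoint:
  fixes g g' :: "'a :: idom fps"
  assumes y': "y' = - y - of_nat N" and m: "m > 0"
  shows "fps_nth (conest y M g m m * g') N = fps_nth (conest y' M g' m m * g) N"
proof -
  have y: "y = - y' - of_nat N" using y' by simp
  obtain l where l: "m = Suc l" using m by (cases m) auto
  have "(-1) ^ m * fps_nth (conest y M g m m * g') N = (-1) ^ m * fps_nth (conest y' M g' m m * g) N"
    unfolding conest_adjoint[OF y' m, symmetric] conest_adjoint[OF y m, symmetric]
    by (simp add: l mult_ac)
  then show ?thesis by simp
qed

section \<open>Symbols of the nested operators\<close>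

lemma twisted_deriv_add: "twisted_deriv y (f + g) = twisted_deriv y f + twisted_deriv y g"
  by (rule fps_ext) (simp add: twisted_deriv_def algebra_simps)

lemma twisted_deriv_cmult: "twisted_deriv y (fps_const c * f) = fps_const c * twisted_deriv y f"
  by (rule fps_ext) (simp add: twisted_deriv_def mult_ac)

text \<open>Multiplication by \<open>q\<close> turns \<open>exp (y x)\<close> into
  \<open>exp ((y + 1) x)\<close>.\<close>

lemma twisted_deriv_X: "twisted_deriv y (fps_X * f) = fps_X * twisted_deriv (y + 1) f"
  by (rule fps_ext) (auto simp: twisted_deriv_def algebra_simps of_nat_diff gr0_conv_Suc)

lemma nest_add: "nest y M (f + g) p = nest y M f p + nest y M g p"
  by (induction p) (simp_all add: twisted_deriv_add distrib_left)

lemma nest_cmult: "nest y M (fps_const c * f) p = fps_const c * nest y M f p"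
  by (induction p) (simp_all only: nest.simps twisted_deriv_cmult mult.left_commute)

lemma nest_X: "nest y M (fps_X * f) p = fps_X * nest (y + 1) M f p"
  by (induction p) (simp_all add: twisted_deriv_X mult_ac)

lemma conest_add: "conest y M (f + g) m i = conest y M f m i + conest y M g m i"
  by (induction i) (simp_all add: twisted_deriv_add nest_add distrib_left)

lemma conest_cmult: "conest y M (fps_const c * f) m i = fps_const c * conest y M f m i"
  by (induction i) (simp_all only: conest.simps nest_cmult twisted_deriv_cmult mult.left_commute)

lemma conest_X: "conest y M (fps_X * f) m i = fps_X * conest (y + 1) M f m i"
  by (induction i) (simp_all add: twisted_deriv_X nest_X mult_ac)

text \<open>By linearity and the shift rule, the action on \<open>q ^ b\<close> is the symbol, that
  is the action on 1, taken at \<open>y + b\<close>.\<close>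

lemma conest_nth:
  "fps_nth (conest y M g m i) N = (\<Sum>b\<le>N. fps_nth g b * fps_nth (conest (y + of_nat b) M 1 m i) (N - b))"
proof (induction N arbitrary: y g)
  have g: "g = fps_const (fps_nth g 0) * 1 + fps_X * fps_shift 1 g" for g :: "'a fps"
    by (rule fps_ext) (auto simp: gr0_conv_Suc)
  have c: "conest y M g m i = fps_const (fps_nth g 0) * conest y M 1 m i + fps_X * conest (y + 1) M (fps_shift 1 g) m i" for y g
    by (subst g) (simp only: conest_add conest_cmult conest_X)
  {
    case 0
    show ?case by (subst c) simp
  next
    case (Suc N)
    have "fps_nth (conest y M g m i) (Suc N) = fps_nth g 0 * fps_nth (conest y M 1 m i) (Suc N) +
        fps_nth (conest (y + 1) M (fps_shift 1 g) m i) N"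
      by (subst c) simp
    also have "\<dots> = fps_nth g 0 * fps_nth (conest y M 1 m i) (Suc N) +
        (\<Sum>b\<le>N. fps_nth g (Suc b) * fps_nth (conest (y + of_nat (Suc b)) M 1 m i) (N - b))"
      unfolding Suc.IH by (simp add: add_ac)
    finally show ?case by (subst sum.atMost_Suc_shift) simp
  }
qed

section \<open>Polynomial dependence on \<open>y\<close>\<close>

definition poly_fun :: "nat \<Rightarrow> (complex \<Rightarrow> complex) \<Rightarrow> bool" where
  "poly_fun d F \<longleftrightarrow> (\<exists>p. degree p \<le> d \<and> (\<forall>y. F y = poly p y))"

lemma has_fps_expansion_poly: "poly p has_fps_expansion fps_of_poly (p :: complex poly)"
  by (simp add: has_fps_expansion_def)

lemma pcompose_X_power: "[:0, 1:] ^ n \<circ>\<^sub>p r = (r :: 'a :: comm_ring_1 poly) ^ n"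
  by (induction n) (simp_all add: pcompose_1 pcompose_mult pcompose_pCons)

lemma poly_fun_const: "poly_fun d (\<lambda>_. c)"
  unfolding poly_fun_def by (intro exI[of _ "[:c:]"]) simp

lemma poly_fun_add: "poly_fun d F \<Longrightarrow> poly_fun d G \<Longrightarrow> poly_fun d (\<lambda>y. F y + G y)"
  unfolding poly_fun_def by (metis degree_add_le poly_add)

lemma poly_fun_cmult: "poly_fun d F \<Longrightarrow> poly_fun d (\<lambda>y. c * F y)"
  unfolding poly_fun_def by (metis degree_smult_le order_trans poly_smult)

lemma poly_fun_sum: "(\<And>i. i \<in> A \<Longrightarrow> poly_fun d (F i)) \<Longrightarrow> poly_fun d (\<lambda>y. \<Sum>i\<in>A. F i y)"
  by (induction A rule: infinite_finite_induct) (auto intro: poly_fun_const poly_fun_add)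

lemma poly_fun_linear: "poly_fun d F \<Longrightarrow> poly_fun (Suc d) (\<lambda>y. (c + a * y) * F y)"
proof -
  assume "poly_fun d F"
  then obtain p where p: "degree p \<le> d" "\<And>y. F y = poly p y" by (auto simp: poly_fun_def)
  have "degree ([:c, a:] * p) \<le> degree [:c, a:] + degree p" by (rule degree_mult_le)
  then show ?thesis
    unfolding poly_fun_def using p by (intro exI[of _ "[:c, a:] * p"]) (auto simp: algebra_simps split: if_splits)
qed

lemma poly_fun_twisted_deriv:
  assumes "\<And>n. poly_fun d (\<lambda>y. fps_nth (f y) n)"
  shows "poly_fun (Suc d) (\<lambda>y. fps_nth (N * twisted_deriv y (f y)) n)"
  unfolding fps_mult_nth
  using poly_fun_linear[OF assms, of _ 1]
  by (auto intro!: poly_fun_sum poly_fun_cmult simp: twisted_deriv_def)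

lemma poly_fun_nest: "poly_fun p (\<lambda>y. fps_nth (nest y M 1 p) n)"
proof (induction p arbitrary: n)
  case (Suc p)
  then show ?case using poly_fun_twisted_deriv[of p "\<lambda>y. nest y M 1 p"] by simp
qed (simp add: poly_fun_const)

lemma poly_fun_conest: "poly_fun (m + i) (\<lambda>y. fps_nth (conest y M 1 m i) n)"
proof (induction i arbitrary: n)
  case (Suc i)
  then show ?case using poly_fun_twisted_deriv[of "m + i" "\<lambda>y. conest y M 1 m i"] by simp
qed (simp add: poly_fun_nest)

text \<open>A polynomial of degree at most \<open>2m\<close> with zeros of order \<open>m + 1\<close> at \<open>0\<close> and, by symmetry, at \<open>-N\<close>.\<close>

lemma poly_fun_symmetric_eq_0:
  assumes d: "poly_fun (2 * m) F" and sym: "\<And>y. F (- y - of_nat N) = F y" and N: "N > 0"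
    and ex: "F has_fps_expansion E" "\<And>j. j \<le> m \<Longrightarrow> fps_nth E j = 0"
  shows "F y = 0"
proof -
  obtain p where p: "degree p \<le> 2 * m" "F = poly p"
    using d by (auto simp: poly_fun_def fun_eq_iff)
  have "poly p has_fps_expansion fps_of_poly p" by (rule has_fps_expansion_poly)
  then have E: "E = fps_of_poly p"
    using ex(1) p(2) fps_expansion_unique_complex by blast
  have dvd: "monom 1 (Suc m) dvd p"
    using ex(2) by (auto simp: monom_1_dvd_iff' E less_Suc_eq_le)
  let ?r = "[:- of_nat N, -1 :: complex:]"
  have "poly (p \<circ>\<^sub>p ?r) = poly p"
    using sym p(2) by (simp add: poly_pcompose algebra_simps fun_eq_iff)
  then have pr: "p \<circ>\<^sub>p ?r = p" by (simp add: poly_eq_poly_eq_iff)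
  obtain s where s: "p = [:0, 1:] ^ Suc m * s" using dvd by (auto simp: monom_altdef elim: dvdE)
  have "p = ([:0, 1:] ^ Suc m \<circ>\<^sub>p ?r) * (s \<circ>\<^sub>p ?r)"
    using pr s by (metis pcompose_mult)
  also have "[:0, 1:] ^ Suc m \<circ>\<^sub>p ?r = ?r ^ Suc m"
    by (rule pcompose_X_power)
  also have "?r = (-1) * [:- (- of_nat N), 1:]" by simp
  finally have dvd': "[:- (- of_nat N), 1:] ^ Suc m dvd p"
    unfolding power_mult_distrib by (metis dvd_triv_right dvd_mult2)
  have "2 * m + 2 \<le> degree p" if "p \<noteq> 0"
  proof -
    have s0: "s \<noteq> 0" using that s by auto
    have "Suc m \<le> order (- of_nat N) p"
      using dvd' that order_divides by blast
    also have "\<dots> = order (- of_nat N) ([:0, 1 :: complex:] ^ Suc m) + order (- of_nat N) s"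
      using that unfolding s by (rule order_mult)
    also have "order (- of_nat N) ([:0, 1 :: complex:] ^ Suc m) = 0"
      using N by (intro order_0I) (simp add: poly_power)
    also have "order (- of_nat N) s \<le> degree s" by (rule order_degree[OF s0])
    finally have "Suc m \<le> degree s" by simp
    moreover have "degree p = Suc m + degree s"
      unfolding s using s0 by (subst degree_mult_eq) (auto simp: degree_power_eq simp del: power_Suc)
    ultimately show ?thesis by simp
  qed
  then have "p = 0" using p(1) by auto
  then show ?thesis by (simp add: p(2))
qed

section \<open>The hypergeometric operator\<close>

text \<open>The coefficients in \<open>q\<close> of \<open>exp (-y x) w(x,y)\<close> for a complex
  number \<open>y\<close>; \<open>w_ratio\<close> is their expansion at
  \<open>y = 0\<close>.\<close>

definition hg_series :: "nat \<Rightarrow> complex \<Rightarrow> complex fps" where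
  "hg_series k y = Abs_fps (\<lambda>b. \<Prod>i<b. hg_ratio k (y + of_nat i))"

lemma hg_prod_eq:
  "(\<Prod>i<d. hg_ratio k (y + of_nat i)) =
    (\<Prod>j=1..k*d. of_nat j + of_nat k * y) / (\<Prod>j=1..d. (of_nat j + y) ^ k)"
proof (induction d)
  case (Suc d)
  have "(\<Prod>j=1..k * Suc d. of_nat j + of_nat k * y) =
      (\<Prod>j=1..k*d. of_nat j + of_nat k * y) * (\<Prod>j=k*d+1..k*d+k. of_nat j + of_nat k * y)"
    using prod.ub_add_nat[of 1 "k * d" "\<lambda>j. of_nat j + of_nat k * y" k] by (simp add: add.commute)
  also have "(\<Prod>j=k*d+1..k*d+k. of_nat j + of_nat k * y) = (\<Prod>j=1..k. of_nat k * (y + of_nat d) + of_nat j)"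
    using prod.shift_bounds_cl_nat_ivl[of "\<lambda>j. of_nat j + of_nat k * y" 1 "k * d" k]
    by (simp add: algebra_simps)
  finally show ?case
    using Suc by (simp add: hg_ratio_def add_ac)
qed simp

lemma fps_nth_0_prod: "fps_nth (\<Prod>i\<in>A. f i) 0 = (\<Prod>i\<in>A. fps_nth (f i) 0 :: 'a :: comm_ring_1)"
  by (induction A rule: infinite_finite_induct) simp_all

lemma hg_series_expansion: "(\<lambda>y. fps_nth (hg_series k y) b) has_fps_expansion w_ratio k b"
proof -
  have "(\<lambda>y. (\<Prod>j=1..k*b. of_nat j + of_nat k * y) / (\<Prod>j=1..b. (of_nat j + y) ^ k)) has_fps_expansion w_ratio k b"
    unfolding w_ratio_def fps_of_nat[symmetric]
    by (intro fps_expansion_intros) (simp add: fps_nth_0_prod fps_nth_power_0)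
  then show ?thesis by (simp only: hg_series_def fps_nth_Abs_fps hg_prod_eq)
qed

lemma expansion_mult:
  assumes "\<And>n. (\<lambda>y. fps_nth (f y) n) has_fps_expansion fps_nth F n"
  shows "(\<lambda>y. fps_nth (M * f y) n) has_fps_expansion fps_nth (const_in_y M * F) n"
  unfolding fps_mult_nth const_in_y_def fps_nth_Abs_fps by (intro fps_expansion_intros assms)

lemma expansion_twisted_deriv:
  assumes "\<And>n. (\<lambda>y. fps_nth (f y) n) has_fps_expansion fps_nth F n"
  shows "(\<lambda>y. fps_nth (twisted_deriv y (f y)) n) has_fps_expansion fps_nth (twisted_deriv fps_X F) n"
  unfolding twisted_deriv_def fps_nth_Abs_fps fps_of_nat[symmetric] by (intro fps_expansion_intros assms)

lemma expansion_nest: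
  assumes "\<And>n. (\<lambda>y. fps_nth (g y) n) has_fps_expansion fps_nth G n"
  shows "(\<lambda>y. fps_nth (nest y M (g y) p) n) has_fps_expansion fps_nth (nest fps_X (\<lambda>i. const_in_y (M i)) G p) n"
  by (induction p arbitrary: n) (simp_all add: expansion_mult expansion_twisted_deriv assms)

lemma expansion_conest:
  assumes "\<And>n. (\<lambda>y. fps_nth (g y) n) has_fps_expansion fps_nth G n"
  shows "(\<lambda>y. fps_nth (conest y M (g y) m i) n) has_fps_expansion fps_nth (conest fps_X (\<lambda>i. const_in_y (M i)) G m i) n"
  by (induction i arbitrary: n) (simp_all add: expansion_mult expansion_twisted_deriv expansion_nest assms)

lemma nest_hg_expansion:
  "(\<lambda>y. fps_nth (nest y (L_inv k) (hg_series k y) p) b) has_fps_expansion fps_nth (formal_nest k p) b"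
  by (rule expansion_nest) (simp add: hg_series_expansion)

lemma L_inv_0: "fps_nth (L_inv k i) 0 = 1"
  using Lt_structure[of k i] by (simp add: L_inv_def)

lemma formal_nest_nth:
  "j < p \<Longrightarrow> fps_nth (fps_nth (formal_nest k p) b) j = 0"
  "fps_nth (fps_nth (formal_nest k p) b) p = (if b = 0 then 1 else 0)"
  using Lt_structure[of k p] by auto

text \<open>This expresses that \<open>w\<^sub>0, \<dots>, w\<^sub>m\<close> are annihilated. After
  \<open>m\<close> derivatives the coefficients of \<open>y ^ j\<close> are 0 for
  \<open>j < m\<close> and constant in \<open>q\<close> for \<open>j = m\<close>; the next
  derivative kills the latter, and further ones create no terms of low order.\<close>

lemma formal_conest_nth:
  assumes "j \<le> m"
  shows "fps_nth (fps_nth (conest fps_X (\<lambda>i. const_in_y (L_inv k i)) (Abs_fps (w_ratio k)) m (Suc i)) b) j = 0"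
  using assms
proof (induction i arbitrary: b j)
  case 0
  have "fps_nth (fps_nth (twisted_deriv fps_X (formal_nest k m)) b) j = 0" for b
    using 0 formal_nest_nth(1)[of _ m k b] formal_nest_nth(2)[of k m b] unfolding twisted_deriv_X_nth by (cases "j = m") auto
  then show ?case by (simp add: const_in_y_mult_nth)
next
  case (Suc i)
  have "fps_nth (fps_nth (twisted_deriv fps_X (conest fps_X (\<lambda>i. const_in_y (L_inv k i)) (Abs_fps (w_ratio k)) m (Suc i))) b) j = 0" for b
    unfolding twisted_deriv_X_nth using Suc by (simp del: conest.simps)
  then show ?case
    unfolding conest.simps(2)[of _ _ _ _ "Suc i"] const_in_y_mult_nth by simp
qed

text \<open>
  The coefficients in \<open>q\<close> of the symbol of \<open>(d/dx)\<^sup>2\<^sup>m - k q (k d/dx + 1) \<dots> (k d/dx + 2m)\<close>.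
\<close>

definition pf_symbol :: "nat \<Rightarrow> nat \<Rightarrow> nat \<Rightarrow> complex \<Rightarrow> complex" where
  "pf_symbol k m N y = (if N = 0 then y ^ (2 * m)
     else if N = 1 then - of_nat k * (\<Prod>j=1..2*m. of_nat k * y + of_nat j) else 0)"

lemma poly_fun_pf_symbol: "poly_fun (2 * m) (pf_symbol k m N)"
proof -
  have 1: "poly_fun n (\<lambda>y. y ^ n)" for n
  proof (induction n)
    case (Suc n)
    then show ?case using poly_fun_linear[of n "\<lambda>y. y ^ n" 0 1] by simp
  qed (simp add: poly_fun_const)
  have 2: "poly_fun n (\<lambda>y. \<Prod>j=1..n. of_nat k * y + of_nat j)" for n
  proof (induction n)
    case (Suc n)
    then show ?case
      using poly_fun_linear[of n "\<lambda>y. \<Prod>j=1..n. of_nat k * y + of_nat j" "of_nat (Suc n)" "of_nat k"]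
      by (simp add: prod.nat_ivl_Suc' add.commute mult.commute)
  qed (simp add: poly_fun_const)
  consider "N = 0" | "N = 1" | "N > 1" by linarith
  then show ?thesis
  proof cases
    case 1
    have "pf_symbol k m N = (\<lambda>y. y ^ (2 * m))" by (simp add: pf_symbol_def 1 fun_eq_iff)
    then show ?thesis using \<open>\<And>n. poly_fun n (\<lambda>y. y ^ n)\<close> by simp
  next
    case 2
    have "pf_symbol k m N = (\<lambda>y. - of_nat k * (\<Prod>j=1..2*m. of_nat k * y + of_nat j))"
      by (simp add: pf_symbol_def 2 fun_eq_iff)
    then show ?thesis
      using poly_fun_cmult[OF \<open>\<And>n. poly_fun n (\<lambda>y. \<Prod>j=1..n. of_nat k * y + of_nat j)\<close>, where c = "- of_nat k"] by simp
  next
    case 3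
    then have "pf_symbol k m N = (\<lambda>y. 0)" by (simp add: pf_symbol_def fun_eq_iff)
    then show ?thesis using poly_fun_const by simp
  qed
qed

text \<open>Under \<open>y \<mapsto> -y - 1\<close> the factors with index \<open>j\<close> and
  \<open>k - j\<close> change places up to sign, and their number \<open>2 m\<close> is
  even.\<close>

lemma pf_symbol_symmetric:
  assumes "k = 2 * m + 1"
  shows "pf_symbol k m N (- y - of_nat N) = pf_symbol k m N y"
proof (cases "N = 1")
  case True
  have "(\<Prod>j=1..2*m. of_nat k * (- y - 1) + of_nat j) = (\<Prod>j=1..2*m. (-1) * (of_nat k * y + of_nat (1 + 2 * m - j)))"
  proof (rule prod.cong)
    fix j assume "j \<in> {1..2 * m}"
    then have "of_nat (1 + 2 * m - j) = (of_nat k - of_nat j :: complex)" using assms by (simp add: of_nat_diff)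
    then show "of_nat k * (- y - 1) + of_nat j = (-1) * (of_nat k * y + of_nat (1 + 2 * m - j))"
      by (simp only:) (simp add: algebra_simps)
  qed simp
  also have "\<dots> = (\<Prod>j=1..2*m. of_nat k * y + of_nat (1 + 2 * m - j))"
    unfolding prod.distrib by simp
  also have "\<dots> = (\<Prod>j=1..2*m. of_nat k * y + of_nat j)"
    using prod.atLeastAtMost_rev[of "\<lambda>j. of_nat k * y + of_nat j" 1 "2 * m"] by (simp add: add.commute)
  finally show ?thesis using True by (simp add: pf_symbol_def)
qed (auto simp: pf_symbol_def)

text \<open>Only two neighbouring coefficients enter, and \<open>hg_ratio\<close> relates them. Its
  numerator factor with \<open>j = k\<close> is \<open>k (s + 1)\<close> and cancels one of the
  \<open>k\<close> factors \<open>s + 1\<close> below, which explains the order \<open>2 m\<close>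
  instead of \<open>k\<close>.\<close>

lemma pf_symbol_annihilates:
  assumes k: "k = 2 * m + 1" and N: "N > 0" and y: "y + of_nat N \<noteq> 0"
  shows "(\<Sum>b\<le>N. fps_nth (hg_series k y) b * pf_symbol k m (N - b) (y + of_nat b)) = 0"
proof -
  obtain M where M: "N = Suc M" using N by (cases N) auto
  let ?h = "fps_nth (hg_series k y)"
  let ?s = "y + of_nat M"
  have s: "?s + 1 \<noteq> 0" using y by (simp add: M add_ac)
  have "(\<Prod>j=1..k. of_nat k * ?s + of_nat j) = (\<Prod>j=1..2*m. of_nat k * ?s + of_nat j) * (of_nat k * (?s + 1))"
    by (simp add: k algebra_simps)
  then have r: "hg_ratio k ?s * (?s + 1) ^ (2 * m) = of_nat k * (\<Prod>j=1..2*m. of_nat k * ?s + of_nat j)"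
    using s by (simp add: hg_ratio_def k power_add divide_simps del: of_nat_Suc)
  have "(\<Sum>b\<le>N. ?h b * pf_symbol k m (N - b) (y + of_nat b)) =
      (\<Sum>b\<in>{M, N}. ?h b * pf_symbol k m (N - b) (y + of_nat b))"
    by (rule sum.mono_neutral_right) (auto simp: M pf_symbol_def)
  also have "\<dots> = ?h M * pf_symbol k m 1 ?s + ?h (Suc M) * pf_symbol k m 0 (?s + 1)"
    by (simp add: M add_ac)
  also have "?h (Suc M) = ?h M * hg_ratio k ?s" by (simp add: hg_series_def)
  also have "?h M * pf_symbol k m 1 ?s + ?h M * hg_ratio k ?s * pf_symbol k m 0 (?s + 1) =
      ?h M * (pf_symbol k m 1 ?s + hg_ratio k ?s * (?s + 1) ^ (2 * m))"
    by (simp add: pf_symbol_def algebra_simps)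
  also have "\<dots> = 0" unfolding r by (simp add: pf_symbol_def)
  finally show ?thesis .
qed

lemma conest_nth_0:
  assumes "\<And>i. fps_nth (M i) 0 = 1"
  shows "fps_nth (conest y M 1 m i) 0 = y ^ (m + i)"
proof -
  have "fps_nth (nest y M 1 p) 0 = y ^ p" for p
    by (induction p) (simp_all add: assms twisted_deriv_def)
  then show ?thesis
    by (induction i) (simp_all add: assms twisted_deriv_def)
qed

text \<open>Induction on the degree in \<open>q\<close>. On \<open>hg_series\<close>, the symbols of
  lower degree act as those of \<open>pf_symbol\<close>, which annihilates the series; so in degree
  \<open>N\<close> just the difference \<open>F\<close> of the two symbols remains. Its expansion at
  0 is then governed by \<open>formal_conest_nth\<close>.\<close>

lemma conest_eq_pf_symbol:
  assumes k: "k = 2 * m + 1" "m > 0"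
  shows "fps_nth (conest y (L_inv k) 1 m m) N = pf_symbol k m N y"
proof (induction N arbitrary: y rule: less_induct)
  case (less N)
  show ?case
  proof (cases "N = 0")
    case True
    then show ?thesis by (simp add: conest_nth_0 L_inv_0 pf_symbol_def mult_2)
  next
    case False
    define F where "F = (\<lambda>y. fps_nth (conest y (L_inv k) 1 m m) N + (-1) * pf_symbol k m N y)"
    let ?E = "fps_nth (conest fps_X (\<lambda>i. const_in_y (L_inv k i)) (Abs_fps (w_ratio k)) m m) N"
    have "F y = 0"
    proof (rule poly_fun_symmetric_eq_0[of m F N ?E])
      show "poly_fun (2 * m) F"
        unfolding F_def using poly_fun_conest[of m m "L_inv k" N]
        by (intro poly_fun_add poly_fun_cmult poly_fun_pf_symbol) (simp add: mult_2)
      show "F (- y - of_nat N) = F y" for y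
        using conest_self_adjoint[where y = y and N = N and M = "L_inv k" and g = 1 and g' = 1, OF refl k(2)]
        by (simp add: F_def pf_symbol_symmetric[OF k(1)])
      have "fps_nth (conest y (L_inv k) (hg_series k y) m m) N = F y" if "y + of_nat N \<noteq> 0" for y
      proof -
        let ?h = "fps_nth (hg_series k y)"
        have split: "{..N} = insert 0 {1..N}" by auto
        have "fps_nth (conest y (L_inv k) (hg_series k y) m m) N =
            (\<Sum>b\<le>N. ?h b * fps_nth (conest (y + of_nat b) (L_inv k) 1 m m) (N - b))"
          by (rule conest_nth)
        also have "\<dots> = fps_nth (conest y (L_inv k) 1 m m) N +
            (\<Sum>b=1..N. ?h b * pf_symbol k m (N - b) (y + of_nat b))"
          unfolding split using less by (simp add: hg_series_def)
        also have "\<dots> = F y + (\<Sum>b\<le>N. ?h b * pf_symbol k m (N - b) (y + of_nat b))"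
          unfolding split by (simp add: F_def hg_series_def)
        finally show ?thesis using pf_symbol_annihilates[OF k(1) _ that] False by simp
      qed
      moreover have "\<forall>\<^sub>F y in nhds 0. y + of_nat N \<noteq> (0 :: complex)"
      proof -
        have "\<forall>\<^sub>F y in nhds 0. y \<noteq> (- of_nat N :: complex)"
          using False by (intro t1_space_nhds) simp
        then show ?thesis by eventually_elim (simp add: add_eq_0_iff2)
      qed
      ultimately have ev: "\<forall>\<^sub>F y in nhds 0. fps_nth (conest y (L_inv k) (hg_series k y) m m) N = F y"
        by (auto elim: eventually_mono)
      have "(\<lambda>y. fps_nth (conest y (L_inv k) (hg_series k y) m m) N) has_fps_expansion ?E"
        by (rule expansion_conest) (simp add: hg_series_expansion)
      then show "F has_fps_expansion ?E"
        using has_fps_expansion_cong[OF ev refl] by simp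
      show "fps_nth ?E j = 0" if "j \<le> m" for j
        using formal_conest_nth[OF that, of k "m - 1" N] k by simp
    qed (use False in simp)
    then show ?thesis by (simp add: F_def)
  qed
qed

text \<open>As in Frobenius' method, only the indicial term survives.\<close>

lemma conest_hg_series:
  assumes k: "k = 2 * m + 1" "m > 0" and y: "\<And>N. N > 0 \<Longrightarrow> y + of_nat N \<noteq> 0"
  shows "conest y (L_inv k) (hg_series k y) m m = fps_const (y ^ (2 * m))"
proof (rule fps_ext)
  fix N
  show "fps_nth (conest y (L_inv k) (hg_series k y) m m) N = fps_nth (fps_const (y ^ (2 * m))) N"
    unfolding conest_nth[of _ _ "hg_series k y"] conest_eq_pf_symbol[OF k]
    using pf_symbol_annihilates[OF k(1) _ y, of N] y by (cases "N = 0") (simp_all add: pf_symbol_def hg_series_def)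
qed

text \<open>Moving all derivatives to the factor with \<open>y\<close> collapses it to a constant by
  \<open>conest_hg_series\<close>, and only \<open>hg_series k y'\<close> is left.\<close>

lemma hg_pairing:
  assumes k: "k = 2 * m + 1" "m > 0" and y: "\<And>N. N > 0 \<Longrightarrow> y + of_nat N \<noteq> 0"
    and y': "y' = - y - of_nat N"
  shows "fps_nth (twisted_deriv y (nest y (L_inv k) (hg_series k y) (m - 1)) * nest y' (L_inv k) (hg_series k y') m) N =
    (-1) ^ m * y ^ (2 * m) * fps_nth (hg_series k y') N"
proof -
  obtain l where l: "m = Suc l" using k(2) by (cases m) auto
  have "twisted_deriv y (nest y (L_inv k) (hg_series k y) (m - 1)) * nest y' (L_inv k) (hg_series k y') m =
      nest y (L_inv k) (hg_series k y) m * twisted_deriv y' (nest y' (L_inv k) (hg_series k y') (m - 1))"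
    by (simp add: l mult_ac)
  then show ?thesis
    using conest_adjoint[OF y' k(2), of "L_inv k" "hg_series k y" "hg_series k y'"]
    by (simp add: conest_hg_series[OF k y])
qed

section \<open>The expansion of \<open>F_o\<close>\<close>

definition odd_series :: "complex fps \<Rightarrow> exp_series" where
  "odd_series g = odd_exp_series (\<lambda>d. fps_nth g (d - 1))"

lemma odd_series_eq: "odd_series g = fps_X * q_series g"
proof (rule fps_ext)
  fix n :: nat
  show "fps_nth (odd_series g) n = fps_nth (fps_X * q_series g) n"
  proof (cases "odd n")
    case True
    then obtain b where "n = 2 * b + 1" by (elim oddE)
    then show ?thesis by (simp add: odd_series_def odd_exp_series_def q_series_nth)
  next
    case False
    then show ?thesis by (cases n) (simp_all add: odd_series_def odd_exp_series_def q_series_nth)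
  qed
qed

lemma odd_series_mult: "odd_series (f * g) = q_series f * odd_series g"
  by (simp add: odd_series_eq q_series_mult mult_ac)

lemma ddx_odd_series: "ddx (odd_series g) = odd_series (twisted_deriv (1 / 2) g)"
  by (rule fps_ext)
    (auto simp: ddx_def odd_series_def odd_exp_series_def twisted_deriv_def algebra_simps add_divide_distrib
      pderiv_pCons elim!: oddE)

lemma nested_odd_series: "nested (Lt k) (odd_series g) p = odd_series (nest (1 / 2) (L_inv k) g p)"
proof -
  have "recip (Lt k i) = q_series (L_inv k i)" for i
    using recip_q_series[of "L_series k i"] Lt_structure[of k i] by (simp add: L_inv_def)
  then show ?thesis
    by (induction p) (simp_all add: odd_series_mult ddx_odd_series del: Lt.simps)
qed

section \<open>Odd double factorials and the series \<open>tau\<close>\<close>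

lemma odd_double_fact_Suc: "odd n \<Longrightarrow> odd_double_fact (n + 2) = odd_double_fact n * (n + 2)"
proof -
  assume n: "odd n"
  have "{i. odd i \<and> i \<le> n + 2} = insert (n + 2) {i. odd i \<and> i \<le> n}"
    using n by (auto simp: le_Suc_eq)
  then show ?thesis by (simp add: odd_double_fact_def)
qed

lemma odd_double_fact_add: "odd n \<Longrightarrow> odd_double_fact (n + 2 * l) = odd_double_fact n * (\<Prod>j=1..l. n + 2 * j)"
proof (induction l)
  case (Suc l)
  then show ?case using odd_double_fact_Suc[of "n + 2 * l"] by (simp add: mult_ac)
qed simp

text \<open>So \<open>tau\<close> is a multiple of \<open>w(x, 1/2)\<close>. Twice the factors
  \<open>k (d + 1/2) + j\<close> are the odd numbers by which the double factorial grows, and the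
  powers of 2 cancel against those below. Here \<open>d\<close> counts from 0.\<close>

lemma tau_coeff:
  assumes "odd k"
  shows "2 * of_nat (odd_double_fact (k * (2 * d + 1))) / of_nat (odd_double_fact (2 * d + 1)) ^ k =
    2 * of_nat (odd_double_fact k) * fps_nth (hg_series k (1 / 2)) d"
proof (induction d)
  case 0
  have "odd_double_fact 1 = 1"
  proof -
    have "{i :: nat. odd i \<and> i \<le> 1} = {1}" by (auto simp: le_Suc_eq)
    then show ?thesis by (simp add: odd_double_fact_def)
  qed
  then show ?case by (simp add: hg_series_def)
next
  case (Suc d)
  let ?n = "k * (2 * d + 1)"
  have n: "odd ?n" using assms by simp
  have 1: "odd_double_fact (k * (2 * Suc d + 1)) = odd_double_fact ?n * (\<Prod>j=1..k. ?n + 2 * j)"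
    using odd_double_fact_add[OF n, of k] by (simp add: algebra_simps)
  have 2: "odd_double_fact (2 * Suc d + 1) = odd_double_fact (2 * d + 1) * (2 * d + 3)"
    using odd_double_fact_Suc[of "2 * d + 1"] by (simp add: algebra_simps)
  have "(\<Prod>j=1..k. of_nat k * (1 / 2 + of_nat d) + of_nat j) = (\<Prod>j=1..k. (of_nat (?n + 2 * j) :: complex) / 2)"
    by (intro prod.cong refl) (simp add: field_simps)
  also have "\<dots> = of_nat (\<Prod>j=1..k. ?n + 2 * j) / 2 ^ k"
    by (simp add: prod_dividef)
  finally have 3: "hg_ratio k (1 / 2 + of_nat d) = of_nat (\<Prod>j=1..k. ?n + 2 * j) / of_nat (2 * d + 3) ^ k"
    by (simp add: hg_ratio_def power_divide field_simps flip: power_mult_distrib)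
  have "fps_nth (hg_series k (1 / 2)) (Suc d) = fps_nth (hg_series k (1 / 2)) d * hg_ratio k (1 / 2 + of_nat d)"
    by (simp add: hg_series_def)
  then have "2 * of_nat (odd_double_fact k) * fps_nth (hg_series k (1 / 2)) (Suc d) =
      (2 * of_nat (odd_double_fact ?n) / of_nat (odd_double_fact (2 * d + 1)) ^ k) * hg_ratio k (1 / 2 + of_nat d)"
    using Suc by simp
  then show ?case unfolding 1 2 3 by (simp only: of_nat_mult power_mult_distrib) simp
qed

lemma tau_eq: "odd k \<Longrightarrow> tau k = odd_series (fps_const (2 * of_nat (odd_double_fact k)) * hg_series k (1 / 2))"
proof -
  assume k: "odd k"
  have "2 * of_nat (odd_double_fact (k * (2 * ((n + 1) div 2) - 1))) / of_nat (odd_double_fact (2 * ((n + 1) div 2) - 1)) ^ k =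
      2 * of_nat (odd_double_fact k) * fps_nth (hg_series k (1 / 2)) ((n + 1) div 2 - 1)" if n: "odd n" for n
  proof -
    obtain d where "n = 2 * d + 1" using n by (elim oddE)
    then show ?thesis using tau_coeff[OF k, of d] by simp
  qed
  then show ?thesis
    unfolding tau_def odd_series_def odd_exp_series_def by (intro fps_ext) simp
qed

text \<open>The power \<open>2 ^ m\<close> combines the prefactor \<open>2 ^ (m - 1)\<close> of
  \<open>F_o\<close> with the 2 in \<open>tau\<close>. The coefficient with index
  \<open>d - 1\<close> belongs to \<open>exp ((d - 1/2) x)\<close>.\<close>

definition F_coeffs :: "nat \<Rightarrow> nat \<Rightarrow> complex fps" where
  "F_coeffs k m = fps_const (2 ^ m * of_nat (odd_double_fact k)) * nest (1 / 2) (L_inv k) (hg_series k (1 / 2)) (m - 1)"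

lemma F_o_eq:
  assumes k: "k = 2 * m + 1" "m > 0"
  shows "F_o k = odd_series (F_coeffs k m)"
proof -
  have a: "(k - 3) div 2 = m - 1" using k by simp
  have two: "(2 :: exp_series) ^ (m - 1) = q_series (fps_const (2 ^ (m - 1)))"
  proof -
    have "(2 :: exp_series) = q_series (fps_const 2)"
      by (rule fps_ext) (auto simp: q_series_nth fps_numeral_nth numeral_poly)
    then have "(2 :: exp_series) ^ n = q_series (fps_const (2 ^ n))" for n
    proof (induction n)
      case (Suc n)
      have "fps_const (2 ^ Suc n) = fps_const 2 * fps_const (2 ^ n :: complex)" by simp
      then show ?case using Suc \<open>2 = q_series (fps_const 2)\<close> by (simp only: q_series_mult power_Suc)
    qed (simp add: q_series_1)
    then show ?thesis .
  qed
  have "F_o k = 2 ^ (m - 1) * odd_series (nest (1 / 2) (L_inv k)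
      (fps_const (2 * of_nat (odd_double_fact k)) * hg_series k (1 / 2)) (m - 1))"
  proof -
    have "odd k" using k by simp
    show ?thesis by (simp only: F_o_def a tau_eq[OF \<open>odd k\<close>] nested_odd_series)
  qed
  also have "\<dots> = odd_series (fps_const (2 ^ (m - 1)) * (fps_const (2 * of_nat (odd_double_fact k)) *
      nest (1 / 2) (L_inv k) (hg_series k (1 / 2)) (m - 1)))"
    by (simp only: two nest_cmult odd_series_mult)
  also have "fps_const (2 ^ (m - 1)) * (fps_const (2 * of_nat (odd_double_fact k)) *
      nest (1 / 2) (L_inv k) (hg_series k (1 / 2)) (m - 1)) = F_coeffs k m"
  proof -
    have "(2 :: complex) ^ (m - 1) * 2 = 2 ^ m" using k by (cases m) auto
    then show ?thesis by (simp only: F_coeffs_def mult.assoc[symmetric] fps_const_mult)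
  qed
  finally show ?thesis .
qed

lemma odd_exp_series_inj: "odd_exp_series c = odd_exp_series c' \<Longrightarrow> d \<ge> 1 \<Longrightarrow> c d = c' d"
proof -
  assume eq: "odd_exp_series c = odd_exp_series c'" and d: "d \<ge> 1"
  have "fps_nth (odd_exp_series c) (2 * d - 1) = fps_nth (odd_exp_series c') (2 * d - 1)" using eq by simp
  then show ?thesis using d by (simp add: odd_exp_series_def)
qed

lemma odd_double_fact_eq: "odd_double_fact (2 * m + 1) = (2 * m + 1) * (\<Prod>i=1..m. 2 * m + 1 - 2 * i)"
proof (induction m)
  case 0
  have "{i :: nat. odd i \<and> i \<le> 1} = {1}" by (auto simp: le_Suc_eq)
  then show ?case by (simp add: odd_double_fact_def)
next
  case (Suc m)
  have "(\<Prod>i=1..Suc m. 2 * Suc m + 1 - 2 * i) = (2 * m + 1) * (\<Prod>i=1..m. 2 * m + 1 - 2 * i)"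
    using prod.shift_bounds_cl_Suc_ivl[of "\<lambda>i. 2 * Suc m + 1 - 2 * i" 1 m]
    by (subst prod.atLeast_Suc_atMost) (simp_all del: prod.cl_ivl_Suc)
  then show ?case using Suc odd_double_fact_Suc[of "2 * m + 1"] by (simp add: algebra_simps)
qed

text \<open>Up to signs and powers of \<open>n\<close>, the numerator of \<open>f_disk\<close>
  splits into \<open>k n\<close> for \<open>j = 0\<close>, the next \<open>k M\<close> factors,
  which belong to \<open>hg_series k (- n)\<close>, and \<open>m\<close> last ones, the halves of
  the odd numbers below \<open>k\<close>, which together with \<open>k\<close> form
  \<open>k!!\<close>.\<close>

lemma f_disk_1:
  assumes k: "k = 2 * m + 1" "m > 0" and n: "n = of_nat M + 1 / 2"
  shows "n * f_disk k k (Suc M) 1 = of_nat (odd_double_fact k) / (2 * n) ^ m * fps_nth (hg_series k (- n)) M"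
proof -
  have n0: "n \<noteq> 0" unfolding n by (simp add: complex_eq_iff)
  have od: "(of_nat (odd_double_fact k) :: complex) = of_nat k * of_nat (\<Prod>i=1..m. 2 * m + 1 - 2 * i)"
    by (simp only: k(1) odd_double_fact_eq of_nat_mult)
  let ?A = "\<Prod>j=1..k*M. of_nat j + of_nat k * - n" and ?B = "\<Prod>j=1..M. (of_nat j + - n)"
  have e: "k * Suc M - (k + 1) div 2 = k * M + m" using k by simp
  have c1: "of_nat (2 * Suc M - 1) = 2 * n" using n by simp
  have c2: "of_nat (k * (2 * Suc M - 1)) = 2 * of_nat k * n" using n by (simp add: algebra_simps)
  have num: "(\<Prod>j=0..k * M + m. (of_nat j * - 1 + (2 * of_nat k * n - of_nat j) * 1) / (2 * n)) =
      (\<Prod>j=0..k * M + m. of_nat k * n - of_nat j) / n ^ (k * M + m + 1)"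
  proof -
    have "(\<Prod>j=0..k * M + m. (of_nat j * - 1 + (2 * of_nat k * n - of_nat j) * 1) / (2 * n)) =
        (\<Prod>j=0..k * M + m. (of_nat k * n - of_nat j) / n)"
      by (intro prod.cong refl) (use n0 in \<open>simp add: field_simps\<close>)
    then show ?thesis by (simp add: prod_dividef)
  qed
  have den: "(\<Prod>j=1..M. (of_nat j * - 1 + (2 * n - of_nat j) * 1) / (2 * n)) = (-1) ^ M * ?B / n ^ M"
  proof -
    have "(\<Prod>j=1..M. (of_nat j * - 1 + (2 * n - of_nat j) * 1) / (2 * n)) =
        (\<Prod>j=1..M. (-1) * (of_nat j + - n) / n)"
      by (intro prod.cong refl) (use n0 in \<open>simp add: field_simps\<close>)
    then show ?thesis by (simp only: prod_dividef prod.distrib) simp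
  qed
  have "(\<Prod>j=0..k * M + m. of_nat k * n - of_nat j) =
      of_nat k * n * (\<Prod>j=1..k * M. of_nat k * n - of_nat j) * (\<Prod>j=k * M + 1..k * M + m. of_nat k * n - of_nat j)"
    using prod.ub_add_nat[of 1 "k * M" "\<lambda>j. of_nat k * n - of_nat j" m]
    by (simp add: prod.atLeast_Suc_atMost mult_ac)
  also have "(\<Prod>j=1..k * M. of_nat k * n - of_nat j) = (\<Prod>j=1..k * M. (-1) * (of_nat j + of_nat k * - n))"
    by (intro prod.cong refl) simp
  also have "\<dots> = (-1) ^ (k * M) * ?A"
    by (simp only: prod.distrib) simp
  also have "(\<Prod>j=k * M + 1..k * M + m. of_nat k * n - of_nat j) = (\<Prod>i=1..m. of_nat (2 * m + 1 - 2 * i) / 2)"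
  proof -
    have "(\<Prod>j=k * M + 1..k * M + m. of_nat k * n - of_nat j) = (\<Prod>i=1..m. of_nat k * n - of_nat (i + k * M))"
      using prod.shift_bounds_cl_nat_ivl[of "\<lambda>j. of_nat k * n - of_nat j" 1 "k * M" m] by (simp add: add.commute)
    also have "\<dots> = (\<Prod>i=1..m. of_nat (2 * m + 1 - 2 * i) / 2)"
      by (intro prod.cong refl) (simp add: n k(1) of_nat_diff field_simps)
    finally show ?thesis .
  qed
  also have "\<dots> = of_nat (\<Prod>i=1..m. 2 * m + 1 - 2 * i) / 2 ^ m"
    by (simp add: prod_dividef)
  finally have num': "(\<Prod>j=0..k * M + m. of_nat k * n - of_nat j) =
      n * (-1) ^ (k * M) * ?A * (of_nat (odd_double_fact k) / 2 ^ m)"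
    unfolding od by (simp only: mult_ac times_divide_eq_right times_divide_eq_left)
  have hg: "fps_nth (hg_series k (- n)) M = ?A / ?B ^ k"
    unfolding hg_series_def fps_nth_Abs_fps hg_prod_eq by (simp add: prod_power_distrib)
  have s: "((-1 :: complex) ^ M) ^ k = (-1) ^ (k * M)" by (simp add: mult.commute flip: power_mult)
  have p: "(n ^ M) ^ k = n ^ (k * M)" by (simp add: mult.commute flip: power_mult)
  have "n * f_disk k k (Suc M) 1 =
      n * (2 / (2 * n) * (n * (-1) ^ (k * M) * ?A * (of_nat (odd_double_fact k) / 2 ^ m) / n ^ (k * M + m + 1) /
      ((-1) ^ M * ?B / n ^ M) ^ k))"
    unfolding f_disk_def e c1 c2 using num num' den by simp
  also have "\<dots> = of_nat (odd_double_fact k) / (2 * n) ^ m * (?A / ?B ^ k)"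
    unfolding power_divide power_mult_distrib s p power_add using n0 by (simp add: divide_simps)
  finally show ?thesis unfolding hg .
qed

text \<open>The case \<open>y = 1/2\<close>, \<open>y' = -n\<close> of \<open>hg_pairing\<close>,
  where indeed \<open>y + y' + M = 0\<close>.\<close>

lemma F_coeffs_pairing:
  assumes k: "k = 2 * m + 1" "m > 0" and n: "n = of_nat M + 1 / 2"
  shows "fps_nth (twisted_deriv (1 / 2) (F_coeffs k m) * nest (- n) (L_inv k) (hg_series k (- n)) m) M / (- n) ^ m =
    n * f_disk k k (Suc M) 1"
proof -
  have n0: "n \<noteq> 0" unfolding n by (simp add: complex_eq_iff)
  have h: "1 / 2 + of_nat N \<noteq> (0 :: complex)" for N by (simp add: complex_eq_iff)
  have y': "- n = - (1 / 2) - of_nat M" by (simp add: n)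
  have "fps_nth (twisted_deriv (1 / 2) (F_coeffs k m) * nest (- n) (L_inv k) (hg_series k (- n)) m) M =
      2 ^ m * of_nat (odd_double_fact k) * ((-1) ^ m * (1 / 2) ^ (2 * m) * fps_nth (hg_series k (- n)) M)"
    unfolding F_coeffs_def twisted_deriv_cmult mult.assoc fps_mult_left_const_nth
    by (subst hg_pairing[OF k h y']) simp
  also have "\<dots> = (-1) ^ m * (2 ^ m * (1 / 2) ^ (2 * m)) * (of_nat (odd_double_fact k) * fps_nth (hg_series k (- n)) M)"
    by (simp only: mult_ac)
  also have "2 ^ m * (1 / 2) ^ (2 * m) = 1 / (2 :: complex) ^ m"
    by (simp add: mult_2 power_add power_one_over)
  finally show ?thesis
    unfolding f_disk_1[OF k n] power_minus[of n] using n0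
    by (simp add: power_mult_distrib)
qed

section \<open>The partial fraction expansion\<close>

text \<open>On a large circle around all the points \<open>t h(t)\<close> is smaller than
  \<open>e\<close>, so the integral is at most \<open>2 pi e\<close>, for every
  \<open>e > 0\<close>.\<close>

lemma sum_residues_eq_0:
  assumes fin: "finite pts" and h: "h holomorphic_on - pts"
    and lim: "((\<lambda>t. t * h t) \<longlongrightarrow> 0) at_infinity"
  shows "(\<Sum>p\<in>pts. residue h p) = 0"
proof -
  define s where "s = (\<Sum>p\<in>pts. residue h p)"
  have "norm s \<le> e" if e: "e > 0" for e
  proof -
    have "\<forall>\<^sub>F t in at_infinity. norm (t * h t) < e"
      using lim e by (auto simp: tendsto_iff dist_norm)
    then obtain B where B: "\<And>t. norm t \<ge> B \<Longrightarrow> norm (t * h t) < e"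
      by (auto simp: eventually_at_infinity)
    define R where "R = Max (insert \<bar>B\<bar> (norm ` pts)) + 1"
    have RB: "\<bar>B\<bar> + 1 \<le> R" and Rp: "\<And>p. p \<in> pts \<Longrightarrow> norm p < R"
    proof -
      show "\<bar>B\<bar> + 1 \<le> R" unfolding R_def using fin by (intro add_right_mono Max_ge) auto
      show "norm p < R" if "p \<in> pts" for p
      proof -
        have "norm p \<le> Max (insert \<bar>B\<bar> (norm ` pts))" using fin that by (intro Max_ge) auto
        then show ?thesis by (simp add: R_def)
      qed
    qed
    have R0: "R > 0" using RB by linarith
    have img: "path_image (circlepath 0 R) \<subseteq> UNIV - pts"
      using Rp R0 by force
    have "contour_integral (circlepath 0 R) h =
        2 * pi * \<i> * (\<Sum>p\<in>pts. winding_number (circlepath 0 R) p * residue h p)"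
      by (rule Residue_theorem[of UNIV]) (use fin h img in \<open>auto simp: Compl_eq_Diff_UNIV\<close>)
    also have "(\<Sum>p\<in>pts. winding_number (circlepath 0 R) p * residue h p) = s"
      unfolding s_def by (intro sum.cong refl) (use Rp in \<open>simp add: winding_number_circlepath\<close>)
    finally have eq: "contour_integral (circlepath 0 R) h = 2 * pi * \<i> * s" .
    have "norm (contour_integral (circlepath 0 R) h) \<le> e / R * (2 * pi * R)"
    proof (rule has_contour_integral_bound_circlepath)
      have "h contour_integrable_on circlepath 0 R"
        using img R0 by (intro contour_integrable_continuous_circlepath
          continuous_on_subset[OF holomorphic_on_imp_continuous_on[OF h]]) auto
      then show "(h has_contour_integral contour_integral (circlepath 0 R) h) (circlepath 0 R)"
        by (rule has_contour_integral_integral)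
    next
      fix t :: complex assume "norm (t - 0) = R"
      then have t: "norm t = R" by simp
      then have "norm (t * h t) < e" using RB by (intro B) linarith
      then show "norm (h t) \<le> e / R" using t R0 by (simp add: norm_mult field_simps)
    qed (use e R0 in auto)
    then have "2 * pi * norm s \<le> 2 * pi * e"
      unfolding eq using R0 by (simp add: norm_mult)
    then show ?thesis by simp
  qed
  then have "norm s \<le> 0" by (rule field_le_epsilon[of _ 0, simplified])
  then show ?thesis by (simp add: s_def)
qed

text \<open>The coefficients of \<open>S(y)\<close>. The value at 0 is prescribed because the
  quotient is meaningless there; it is the one given by \<open>formal_nest_nth\<close>.\<close>

definition S_fun :: "nat \<Rightarrow> nat \<Rightarrow> nat \<Rightarrow> complex \<Rightarrow> complex" where
  "S_fun k m b y = (if y = 0 then if b = 0 then 1 else 0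
     else fps_nth (nest y (L_inv k) (hg_series k y) m) b / y ^ m)"

lemma nest_nth_cases:
  "fps_nth (nest y M g 0) b = (\<Sum>i=0..b. fps_nth (M 0) i * fps_nth g (b - i))"
  "fps_nth (nest y M g (Suc p)) b =
    (\<Sum>i=0..b. fps_nth (M (Suc p)) i * ((of_nat (b - i) + y) * fps_nth (nest y M g p) (b - i)))"
  by (simp_all add: fps_mult_nth twisted_deriv_def)

lemma nest_hg_analytic:
  assumes "\<And>p. p < b \<Longrightarrow> y \<noteq> - of_nat (Suc p)"
  shows "(\<lambda>y. fps_nth (nest y (L_inv k) (hg_series k y) m) b) analytic_on {y}"
  using assms
proof (induction m arbitrary: b)
  case 0
  have "y + of_nat i + 1 \<noteq> 0" if "i < b" for i
    using 0[OF that] unfolding eq_neg_iff_add_eq_0 by (simp add: add_ac)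
  then have "(\<lambda>y. fps_nth (hg_series k y) (b - i)) analytic_on {y}" for i
    unfolding hg_series_def fps_nth_Abs_fps hg_ratio_def by (intro analytic_intros) auto
  then show ?case unfolding nest_nth_cases by (intro analytic_intros)
next
  case (Suc m)
  show ?case unfolding nest_nth_cases by (intro analytic_intros Suc.IH Suc.prems) auto
qed

lemma nest_hg_meromorphic: "(\<lambda>y. fps_nth (nest y (L_inv k) (hg_series k y) m) b) meromorphic_on A"
proof (induction m arbitrary: b)
  case 0
  have "(\<lambda>y. fps_nth (hg_series k y) b) meromorphic_on A" for b
    unfolding hg_series_def fps_nth_Abs_fps hg_ratio_def by (intro meromorphic_intros)
  then show ?case unfolding nest_nth_cases by (intro meromorphic_intros)
next
  case (Suc m)
  show ?case unfolding nest_nth_cases by (intro meromorphic_intros Suc)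
qed

text \<open>At 0 the singularity is removable since the formal expansion of the numerator starts at
  \<open>y ^ m\<close>; elsewhere only the poles of \<open>hg_series\<close> matter.\<close>

lemma S_fun_analytic:
  assumes "\<And>p. p < b \<Longrightarrow> y \<noteq> - of_nat (Suc p)"
  shows "S_fun k m b analytic_on {y}"
proof (cases "y = 0")
  case True
  let ?f = "\<lambda>y. fps_nth (nest y (L_inv k) (hg_series k y) m) b" and ?F = "fps_nth (formal_nest k m) b"
  have f: "?f has_fps_expansion ?F" by (rule nest_hg_expansion)
  show ?thesis
  proof (cases "?F = 0")
    case False
    have "m \<le> subdegree ?F" by (rule subdegree_geI) (simp_all add: False formal_nest_nth)
    then have "S_fun k m b has_fps_expansion fps_shift m ?F"
      using has_fps_expansion_shift[OF f, of m "if b = 0 then 1 else 0"]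
      by (simp add: S_fun_def [abs_def] formal_nest_nth)
    then show ?thesis using True has_fps_expansion_imp_analytic_0 by blast
  next
    case F: True
    then have b: "b \<noteq> 0" using formal_nest_nth(2)[of k m b] by (auto split: if_splits)
    have "\<forall>\<^sub>F y in nhds 0. ?f y = 0" using f F by (simp add: has_fps_expansion_0_iff)
    then have "\<forall>\<^sub>F y in nhds 0. S_fun k m b y = 0"
      by eventually_elim (simp add: S_fun_def b)
    then show ?thesis using analytic_at_cong[of "S_fun k m b" "\<lambda>_. 0" 0 0] True by simp
  qed
next
  case False
  have "\<forall>\<^sub>F y in nhds y. y \<noteq> 0" using False by (rule t1_space_nhds)
  then have ev: "\<forall>\<^sub>F y in nhds y. S_fun k m b y = fps_nth (nest y (L_inv k) (hg_series k y) m) b / y ^ m"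
    by eventually_elim (simp add: S_fun_def)
  have "(\<lambda>y. fps_nth (nest y (L_inv k) (hg_series k y) m) b / y ^ m) analytic_on {y}"
    using nest_hg_analytic[OF assms] False by (intro analytic_intros) auto
  then show ?thesis using analytic_at_cong[OF ev refl] by simp
qed

lemma S_fun_meromorphic: "S_fun k m b meromorphic_on A"
proof -
  have "(\<lambda>y. fps_nth (nest y (L_inv k) (hg_series k y) m) b / y ^ m) meromorphic_on A"
    by (intro meromorphic_intros nest_hg_meromorphic)
  moreover have "\<forall>\<^sub>F y in at z. S_fun k m b y = fps_nth (nest y (L_inv k) (hg_series k y) m) b / y ^ m" for z
  proof -
    have "\<forall>\<^sub>F y in at z. y \<noteq> 0" by (rule eventually_neq_at_within)
    then show ?thesis by eventually_elim (simp add: S_fun_def)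
  qed
  ultimately show ?thesis by (subst meromorphic_on_cong[OF _ refl])
qed

lemma tendsto_moebius_at_infinity: "((\<lambda>y. (a * y + c) / (y + d)) \<longlongrightarrow> a) at_infinity"
  for a c d :: complex
proof -
  have ne: "\<forall>\<^sub>F y in at_infinity. y \<noteq> - d"
    by (rule eventually_at_infinityI[of "norm d + 1"]) auto
  have "((\<lambda>y. (c - a * d) / (y + d)) \<longlongrightarrow> 0) at_infinity"
    by (intro tendsto_divide_0[OF tendsto_const] tendsto_add_filterlim_at_infinity'[OF filterlim_ident tendsto_const])
  then have "((\<lambda>y. a + (c - a * d) / (y + d)) \<longlongrightarrow> a + 0) at_infinity"
    by (intro tendsto_add tendsto_const)
  moreover have "\<forall>\<^sub>F y in at_infinity. a + (c - a * d) / (y + d) = (a * y + c) / (y + d)"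
    using ne
  proof eventually_elim
    case (elim y)
    then have "y + d \<noteq> 0" by (simp add: eq_neg_iff_add_eq_0)
    then show ?case by (simp add: field_simps)
  qed
  ultimately show ?thesis by (simp add: tendsto_cong)
qed

text \<open>Numerator and denominator of \<open>hg_ratio\<close> have the same degree, and each of
  the \<open>m\<close> derivatives contributes at most one factor \<open>y\<close>, which
  \<open>y ^ m\<close> compensates. The limit bounds \<open>S_fun\<close> on large circles.\<close>

lemma S_fun_tendsto_infinity: "\<exists>l. (S_fun k m b \<longlongrightarrow> l) at_infinity"
proof -
  have ne0: "\<forall>\<^sub>F y in at_infinity. y \<noteq> (0 :: complex)"
    by (rule eventually_at_infinityI[of 1]) auto
  have hg: "\<exists>l. ((\<lambda>y. fps_nth (hg_series k y) b) \<longlongrightarrow> l) at_infinity" for b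
  proof -
    have eq: "fps_nth (hg_series k y) b =
        (\<Prod>i<b. \<Prod>j=1..k. (of_nat k * y + (of_nat k * of_nat i + of_nat j)) / (y + (of_nat i + 1)))" for y
    proof -
      have "hg_ratio k (y + of_nat i) =
          (\<Prod>j=1..k. (of_nat k * y + (of_nat k * of_nat i + of_nat j)) / (y + (of_nat i + 1)))" for i
        by (simp add: hg_ratio_def prod_dividef distrib_left add.assoc)
      then show ?thesis by (simp only: hg_series_def fps_nth_Abs_fps)
    qed
    have "((\<lambda>y. fps_nth (hg_series k y) b) \<longlongrightarrow> (\<Prod>i<b. \<Prod>j=1..k. of_nat k)) at_infinity"
      unfolding eq by (intro tendsto_prod tendsto_moebius_at_infinity)
    then show ?thesis by blast
  qed
  have "\<exists>l. ((\<lambda>y. fps_nth (nest y (L_inv k) (hg_series k y) m) b / y ^ m) \<longlongrightarrow> l) at_infinity"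
  proof (induction m arbitrary: b)
    case 0
    have "\<exists>l. \<forall>b. ((\<lambda>y. fps_nth (hg_series k y) b) \<longlongrightarrow> l b) at_infinity"
      by (intro choice allI hg)
    then obtain l where l: "\<And>b. ((\<lambda>y. fps_nth (hg_series k y) b) \<longlongrightarrow> l b) at_infinity" by blast
    have "((\<lambda>y. fps_nth (nest y (L_inv k) (hg_series k y) 0) b) \<longlongrightarrow> (\<Sum>i=0..b. fps_nth (L_inv k 0) i * l (b - i))) at_infinity"
      unfolding nest_nth_cases by (intro tendsto_sum tendsto_mult tendsto_const l)
    then show ?case by auto
  next
    case (Suc m)
    let ?f = "\<lambda>b y. fps_nth (nest y (L_inv k) (hg_series k y) m) b / y ^ m"
    have "\<exists>l. \<forall>b. (?f b \<longlongrightarrow> l b) at_infinity"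
      by (intro choice allI Suc)
    then obtain l where l: "\<And>b. (?f b \<longlongrightarrow> l b) at_infinity" by blast
    have "((\<lambda>y. \<Sum>i=0..b. fps_nth (L_inv k (Suc m)) i * ((1 * y + of_nat (b - i)) / (y + 0) * ?f (b - i) y))
        \<longlongrightarrow> (\<Sum>i=0..b. fps_nth (L_inv k (Suc m)) i * (1 * l (b - i)))) at_infinity"
      by (intro tendsto_sum tendsto_mult tendsto_const tendsto_moebius_at_infinity l)
    moreover have "(\<Sum>i=0..b. fps_nth (L_inv k (Suc m)) i * ((1 * y + of_nat (b - i)) / (y + 0) * ?f (b - i) y)) =
        fps_nth (nest y (L_inv k) (hg_series k y) (Suc m)) b / y ^ Suc m" for y
      unfolding nest_nth_cases sum_divide_distrib by (intro sum.cong refl) (simp add: add.commute)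
    ultimately show ?case by auto
  qed
  then obtain l where l: "((\<lambda>y. fps_nth (nest y (L_inv k) (hg_series k y) m) b / y ^ m) \<longlongrightarrow> l) at_infinity"
    by blast
  have "\<forall>\<^sub>F y in at_infinity. fps_nth (nest y (L_inv k) (hg_series k y) m) b / y ^ m = S_fun k m b y"
    using ne0 by eventually_elim (simp add: S_fun_def)
  from tendsto_cong[OF this] show ?thesis using l by blast
qed

text \<open>The share of the leading term 1 of the hypergeometric series in \<open>S(t - 1)\<close>.
  Its only possible pole is \<open>t = 1\<close>.\<close>

definition S_rest :: "nat \<Rightarrow> nat \<Rightarrow> nat \<Rightarrow> complex \<Rightarrow> complex" where
  "S_rest k m b t = fps_nth (nest (t - 1) (L_inv k) 1 m) b / (t - 1) ^ m"

lemma S_rest_analytic: "t \<noteq> 1 \<Longrightarrow> S_rest k m b analytic_on {t}"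
proof -
  assume t: "t \<noteq> 1"
  obtain p where p: "\<And>y. fps_nth (nest y (L_inv k) 1 m) b = poly p y"
    using poly_fun_nest[of m "L_inv k" b] by (auto simp: poly_fun_def)
  have poly: "(\<lambda>t. poly p (t - 1)) analytic_on {t}"
    unfolding poly_altdef by (intro analytic_intros)
  show ?thesis unfolding S_rest_def p by (intro analytic_intros poly) (use t in auto)
qed

text \<open>Without its first term, \<open>w(x,t-1)\<close> is a multiple of
  \<open>w(x,t)\<close>.\<close>

lemma hg_series_shift: "hg_series k (t - 1) = 1 + fps_const (hg_ratio k (t - 1)) * (fps_X * hg_series k t)"
proof (rule fps_ext)
  fix n
  show "fps_nth (hg_series k (t - 1)) n = fps_nth (1 + fps_const (hg_ratio k (t - 1)) * (fps_X * hg_series k t)) n"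
    by (cases n) (simp_all add: hg_series_def prod.lessThan_Suc_shift algebra_simps del: prod.lessThan_Suc)
qed

text \<open>The normalisations by \<open>(t - 1) ^ m\<close> and \<open>t ^ m\<close> supply the
  power in \<open>kernel\<close>, so the factor from the residue calculus reappears here.\<close>

lemma S_fun_shift:
  assumes t: "t \<noteq> 0" "t \<noteq> 1"
  shows "S_fun k m b (t - 1) = (if b = 0 then 0 else kernel k m t * S_fun k m (b - 1) t) + S_rest k m b t"
proof -
  have "nest (t - 1) (L_inv k) (hg_series k (t - 1)) m =
      nest (t - 1) (L_inv k) 1 m + fps_const (hg_ratio k (t - 1)) * (fps_X * nest t (L_inv k) (hg_series k t) m)"
    unfolding hg_series_shift nest_add nest_cmult nest_X by simp
  then show ?thesis using t
    by (simp add: S_fun_def S_rest_def kernel_def power_divide add_divide_distrib mult_ac)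
qed

section \<open>The recursion for the closed form\<close>

abbreviation half_odd :: "nat \<Rightarrow> complex" where
  "half_odd M \<equiv> of_nat M + 1 / 2"

text \<open>The coefficient of \<open>q ^ M\<close> in \<open>exp (-x/2) F_o' S(y)\<close>. The
  family \<open>S\<close> is a parameter so that \<open>S_rest\<close> can take its place.\<close>

definition S_num :: "nat \<Rightarrow> nat \<Rightarrow> (nat \<Rightarrow> nat \<Rightarrow> complex \<Rightarrow> complex) \<Rightarrow> nat \<Rightarrow> complex \<Rightarrow> complex" where
  "S_num k m S M y = (\<Sum>b\<le>M. half_odd b * fps_nth (F_coeffs k m) b * S m (M - b) y)"

text \<open>
  The closed form of the function of \<open>y = z\<^sub>j / (z\<^sub>j - z\<^sub>j\<^sub>+\<^sub>1)\<close> that remains when \<open>z\<^sub>0, \<dots>, z\<^sub>j\<^sub>-\<^sub>1\<close> have been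
  eliminated, summed over all chains of total degree \<open>2 M + 1\<close>.
\<close>

definition disk_sum :: "nat \<Rightarrow> nat \<Rightarrow> nat \<Rightarrow> complex \<Rightarrow> complex" where
  "disk_sum k m M y = S_num k m (S_fun k) M y / (half_odd M + y)"

lemma half_odd_neq: "half_odd M \<noteq> (- of_nat p :: complex)" "half_odd M \<noteq> (of_nat p :: complex)"
proof -
  show "half_odd M \<noteq> (- of_nat p :: complex)" by (simp add: complex_eq_iff)
  have "half_odd M = of_nat (Suc M) - 1 / 2" by simp
  then show "half_odd M \<noteq> (of_nat p :: complex)" using half_odd_neq_nat[of "Suc M" p] by (simp only: not_False_eq_True)
qed

lemma disk_sum_meromorphic: "disk_sum k m M meromorphic_on A"
  unfolding disk_sum_def S_num_def by (intro meromorphic_intros S_fun_meromorphic)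

lemma S_num_analytic:
  assumes "\<And>p. p < M \<Longrightarrow> y \<noteq> - of_nat (Suc p)"
  shows "S_num k m (S_fun k) M analytic_on {y}"
  unfolding S_num_def by (intro analytic_intros S_fun_analytic assms) auto

lemma disk_sum_analytic:
  assumes "\<And>p. p < M \<Longrightarrow> y \<noteq> - of_nat (Suc p)" "y \<noteq> - half_odd M"
  shows "disk_sum k m M analytic_on {y}"
proof -
  have "half_odd M + y \<noteq> 0" using assms(2) unfolding add_eq_0_iff .
  then show ?thesis
    unfolding disk_sum_def by (intro analytic_intros S_num_analytic assms(1)) auto
qed

lemma S_num_shift:
  assumes t: "t \<noteq> 0" "t \<noteq> 1"
  shows "S_num k m (S_fun k) M (t - 1) =
    (if M = 0 then 0 else kernel k m t * S_num k m (S_fun k) (M - 1) t) + S_num k m (S_rest k) M t"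
proof -
  have "S_num k m (S_fun k) M (t - 1) =
      (\<Sum>b\<le>M. half_odd b * fps_nth (F_coeffs k m) b * (if M - b = 0 then 0 else kernel k m t * S_fun k m (M - b - 1) t))
      + S_num k m (S_rest k) M t"
    unfolding S_num_def S_fun_shift[OF t] by (simp only: distrib_left sum.distrib)
  also have "(\<Sum>b\<le>M. half_odd b * fps_nth (F_coeffs k m) b * (if M - b = 0 then 0 else kernel k m t * S_fun k m (M - b - 1) t))
      = (if M = 0 then 0 else kernel k m t * S_num k m (S_fun k) (M - 1) t)"
  proof (cases M)
    case (Suc M')
    have "(\<Sum>b\<le>M'. half_odd b * fps_nth (F_coeffs k m) b * (if M - b = 0 then 0 else kernel k m t * S_fun k m (M - b - 1) t)) =
        (\<Sum>b\<le>M'. kernel k m t * (half_odd b * fps_nth (F_coeffs k m) b * S_fun k m (M' - b) t))"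
      by (intro sum.cong refl) (auto simp: Suc Suc_diff_le)
    then show ?thesis by (simp add: Suc S_num_def sum_distrib_left)
  qed simp
  finally show ?thesis .
qed

lemma S_num_at_pole:
  assumes k: "k = 2 * m + 1" "m > 0"
  shows "S_num k m (S_fun k) M (- half_odd M) = half_odd M * f_disk k k (Suc M) 1"
proof -
  let ?n = "half_odd M"
  have n0: "?n \<noteq> 0" using half_odd_neq(2)[of M 0] by simp
  have "S_num k m (S_fun k) M (- ?n) =
      (\<Sum>b=0..M. fps_nth (twisted_deriv (1 / 2) (F_coeffs k m)) b * fps_nth (nest (- ?n) (L_inv k) (hg_series k (- ?n)) m) (M - b)) / (- ?n) ^ m"
    unfolding S_num_def S_fun_def sum_divide_distrib twisted_deriv_def
    by (intro sum.cong) (simp_all only: n0 neg_equal_0_iff_equal if_False fps_nth_Abs_fps times_divide_eq_right atMost_atLeast0)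
  also have "\<dots> = ?n * f_disk k k (Suc M) 1"
    using F_coeffs_pairing[OF k refl, of M] by (simp only: fps_mult_nth)
  finally show ?thesis .
qed

text \<open>The residues of \<open>disk_sum k m M t / (y - t)\<close> add up to 0. The one at
  \<open>y\<close> is \<open>- disk_sum k m M y\<close>, the one at \<open>- half_odd M\<close> is
  \<open>disk_start\<close>, and those at the negative integers give \<open>ktot\<close> of the
  preceding function. The condition on \<open>y\<close> keeps these points distinct.\<close>

lemma disk_sum_partial_fractions:
  assumes k: "k = 2 * m + 1" "m > 0" and D: "M \<le> D" and y: "2 * y \<notin> \<int> \<or> y = 0"
  shows "disk_sum k m M y = disk_start k (Suc M) y + (if M = 0 then 0 else ktot k m D (disk_sum k m (M - 1)) y)"
proof -
  let ?n = "half_odd M"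
  define h where "h = (\<lambda>t. disk_sum k m M t / (y - t))"
  define pole :: "nat \<Rightarrow> complex" where "pole = (\<lambda>p. - of_nat (Suc p))"
  \<comment> \<open>For \<open>p \<ge> M\<close> there is no pole at \<open>pole p\<close>; such
    points are included to match the range of \<open>ktot\<close>.\<close>
  define pts where "pts = insert y (insert (- ?n) (pole ` {..D}))"
  have yp: "y \<noteq> pole p" for p
  proof
    assume "y = pole p"
    then have "2 * y \<in> \<int>" "y \<noteq> 0" by (auto simp: pole_def intro!: Ints_mult simp del: of_nat_Suc)
    then show False using y by blast
  qed
  have yn: "y \<noteq> - ?n"
  proof
    assume "y = - ?n"
    then have "2 * y = 2 * (- ?n)" by (simp only:)
    also have "\<dots> = - of_nat (2 * M + 1)" by (simp add: distrib_left)
    finally have "2 * y \<in> \<int>" by (simp only: Ints_minus Ints_of_nat)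
    moreover have "y \<noteq> 0"
      unfolding \<open>y = - ?n\<close> neg_equal_0_iff_equal using half_odd_neq(2)[of M 0] by simp
    ultimately show False using y by blast
  qed
  have pn: "- ?n \<noteq> pole p" for p
    using half_odd_neq(2)[of M "Suc p"] unfolding pole_def neg_equal_iff_equal .
  have inj: "inj_on pole {..D}" by (auto simp: inj_on_def pole_def)
  have hol: "h holomorphic_on - pts"
  proof (rule analytic_imp_holomorphic, subst analytic_on_analytic_at, intro ballI)
    fix t assume t: "t \<in> - pts"
    have "disk_sum k m M analytic_on {t}"
      by (rule disk_sum_analytic) (use t D in \<open>auto simp: pts_def pole_def\<close>)
    then show "h analytic_on {t}"
      unfolding h_def by (intro analytic_intros) (use t in \<open>auto simp: pts_def\<close>)
  qed
  \<comment> \<open>\<open>S_num\<close> has a finite limit at infinity, and the two linear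
    denominators make \<open>h\<close> decay like \<open>1 / t ^ 2\<close>.\<close>
  have lim: "((\<lambda>t. t * h t) \<longlongrightarrow> 0) at_infinity"
  proof -
    have "\<exists>l. \<forall>b. (S_fun k m b \<longlongrightarrow> l b) at_infinity"
      by (intro choice allI S_fun_tendsto_infinity)
    then obtain l where l: "\<And>b. (S_fun k m b \<longlongrightarrow> l b) at_infinity" by blast
    have "((\<lambda>t. S_num k m (S_fun k) M t * ((1 * t + 0) / (t + ?n)) * ((0 * t + - 1) / (t + - y))) \<longlongrightarrow>
        (\<Sum>b\<le>M. half_odd b * fps_nth (F_coeffs k m) b * l (M - b)) * 1 * 0) at_infinity"
      unfolding S_num_def
      by (intro tendsto_mult tendsto_sum tendsto_const l tendsto_moebius_at_infinity)
    moreover have "S_num k m (S_fun k) M t * ((1 * t + 0) / (t + ?n)) * ((0 * t + - 1) / (t + - y)) = t * h t" for t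
    proof -
      have "(0 * t + - 1) / (t + - y) = 1 / (y - t)"
        by (simp add: minus_divide_right)
      then show ?thesis by (simp add: h_def disk_sum_def add.commute mult.commute)
    qed
    ultimately show ?thesis by simp
  qed
  have "(\<Sum>p\<in>pts. residue h p) = 0"
    by (rule sum_residues_eq_0[OF _ hol lim]) (simp add: pts_def)
  moreover have "(\<Sum>p\<in>pts. residue h p) = residue h y + (residue h (- ?n) + (\<Sum>p\<le>D. residue h (pole p)))"
    unfolding pts_def using yp yn pn by (auto simp: sum.reindex[OF inj] image_iff)
  moreover have "residue h y = - disk_sum k m M y"
  proof -
    have "disk_sum k m M analytic_on {y}"
      by (rule disk_sum_analytic) (use yp yn in \<open>auto simp: pole_def\<close>)
    then obtain e where e: "e > 0" "disk_sum k m M holomorphic_on ball y e" by (auto simp: analytic_on_def)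
    have "residue (\<lambda>t. (- disk_sum k m M t) / (t - y)) y = - disk_sum k m M y"
      by (rule residue_simple[of "ball y e"]) (use e in \<open>auto intro!: holomorphic_intros\<close>)
    moreover have "h = (\<lambda>t. (- disk_sum k m M t) / (t - y))"
      unfolding h_def by (simp add: fun_eq_iff minus_divide_left [symmetric] minus_divide_right)
    ultimately show ?thesis by simp
  qed
  moreover have "residue h (- ?n) = disk_start k (Suc M) y"
  proof -
    let ?g = "\<lambda>t. S_num k m (S_fun k) M t / (y - t)"
    have "?g analytic_on {- ?n}"
      by (intro analytic_intros S_num_analytic) (use pn yn in \<open>auto simp: pole_def\<close>)
    then obtain e where e: "e > 0" "?g holomorphic_on ball (- ?n) e" by (auto simp: analytic_on_def)
    have "residue (\<lambda>t. ?g t / (t - (- ?n))) (- ?n) = ?g (- ?n)"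
      by (rule residue_simple[of "ball (- ?n) e"]) (use e in auto)
    moreover have "h = (\<lambda>t. ?g t / (t - (- ?n)))"
      by (simp add: h_def disk_sum_def fun_eq_iff add.commute mult.commute)
    ultimately have "residue h (- ?n) = ?g (- ?n)" by (simp only:)
    then have "residue h (- ?n) = half_odd M * f_disk k k (Suc M) 1 / (y + ?n)"
      by (simp only: S_num_at_pole[OF k] diff_minus_eq_add)
    then show ?thesis by (simp add: disk_start_def add_ac)
  qed
  moreover have "residue h (pole p) = (if M = 0 then 0 else kres k m (- of_nat p) (disk_sum k m (M - 1)) y)" for p
  proof -
    let ?q = "- of_nat p :: complex"
    \<comment> \<open>After the shift by one, \<open>S_num_shift\<close> splits the function at
      \<open>-p\<close>: \<open>A\<close> is the integrand of \<open>kres\<close>, while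
      \<open>B\<close> comes from \<open>S_rest\<close> and is regular there.\<close>
    define A where "A = (\<lambda>t. if M = 0 then 0 else kernel k m t * disk_sum k m (M - 1) t / (y + 1 - t))"
    define B where "B = (\<lambda>t. S_num k m (S_rest k) M t / (?n + (t - 1)) / (y + 1 - t))"
    have q1: "?q \<noteq> 1" by (simp add: complex_eq_iff)
    have "residue h (pole p) = residue (\<lambda>x. h (pole p + x)) 0" by (rule residue_shift_0)
    also have "(\<lambda>x. h (pole p + x)) = (\<lambda>x. h ((?q + x) - 1))"
      by (simp add: pole_def algebra_simps)
    also have "residue (\<lambda>x. h ((?q + x) - 1)) 0 = residue (\<lambda>t. h (t - 1)) ?q"
      by (rule residue_shift_0[symmetric])
    also have "\<dots> = residue (\<lambda>t. A t + B t) ?q"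
    proof (rule residue_cong)
      have "\<forall>\<^sub>F t in at ?q. t \<noteq> 0" "\<forall>\<^sub>F t in at ?q. t \<noteq> 1" by (rule eventually_neq_at_within)+
      then show "\<forall>\<^sub>F t in at ?q. h (t - 1) = A t + B t"
      proof eventually_elim
        case (elim t)
        have y1: "y - (t - 1) = y + 1 - t" by simp
        have "of_nat M = (of_nat (M - 1) + 1 :: complex)" if "M \<noteq> 0" using that by (cases M) auto
        then have n1: "?n + (t - 1) = half_odd (M - 1) + t" if "M \<noteq> 0" using that by simp
        show ?case
          unfolding h_def disk_sum_def S_num_shift[OF elim] y1 A_def B_def
          using n1 by (simp add: add_divide_distrib)
      qed
    qed simp
    also have "\<dots> = residue A ?q + residue B ?q"
    proof (rule residue_meromorphic_add)
      show "A meromorphic_on {?q}"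
        unfolding A_def
        by (cases "M = 0") (auto intro!: meromorphic_intros kernel_meromorphic disk_sum_meromorphic)
      show "B meromorphic_on {?q}"
        unfolding B_def S_num_def
        by (intro meromorphic_intros analytic_on_imp_meromorphic_on S_rest_analytic q1)
    qed
    also have "residue B ?q = 0"
    proof (rule residue_analytic)
      have "?n + (?q - 1) \<noteq> 0" using pn[of p] by (auto simp: pole_def algebra_simps add_eq_0_iff)
      moreover have "y + 1 - ?q \<noteq> 0" using yp[of p] by (auto simp: pole_def algebra_simps add_eq_0_iff)
      ultimately show "B analytic_on {?q}"
        unfolding B_def S_num_def by (intro analytic_intros S_rest_analytic q1) auto
    qed
    also have "residue A ?q = (if M = 0 then 0 else kres k m ?q (disk_sum k m (M - 1)) y)"
      by (simp add: A_def kres_def residue_const)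
    finally show ?thesis by simp
  qed
  ultimately have "- disk_sum k m M y + (disk_start k (Suc M) y +
      (\<Sum>p\<le>D. if M = 0 then 0 else kres k m (- of_nat p) (disk_sum k m (M - 1)) y)) = 0"
    by simp
  then have "disk_sum k m M y = disk_start k (Suc M) y +
      (\<Sum>p\<le>D. if M = 0 then 0 else kres k m (- of_nat p) (disk_sum k m (M - 1)) y)"
    by (simp add: algebra_simps)
  then show ?thesis by (cases "M = 0") (simp_all add: ktot_def)
qed

text \<open>Unrolls the recursion: lowering \<open>M\<close> by one costs one more application of
  \<open>ktot\<close>. The exponent \<open>j\<close> is general so that linearity can be used under
  the iterate.\<close>

lemma ktot_pow_disk_sum:
  assumes k: "k = 2 * m + 1" "m > 0" and "M \<le> D"
  shows "(ktot k m D ^^ j) (disk_sum k m M) 0 = (\<Sum>i\<le>M. (ktot k m D ^^ (j + i)) (disk_start k (Suc M - i)) 0)"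
  using assms(3)
proof (induction M arbitrary: j)
  case 0
  have "agree (disk_sum k m 0) (disk_start k (Suc 0))"
    using disk_sum_partial_fractions[OF k] by (simp add: agree_def)
  then show ?case using agree_at_0[OF ktot_pow_cong] by simp
next
  case (Suc M)
  have "agree (disk_sum k m (Suc M)) (\<lambda>y. disk_start k (Suc (Suc M)) y + ktot k m D (disk_sum k m M) y)"
    using disk_sum_partial_fractions[OF k Suc.prems] by (simp add: agree_def)
  then have "(ktot k m D ^^ j) (disk_sum k m (Suc M)) 0 =
      (ktot k m D ^^ j) (\<lambda>y. disk_start k (Suc (Suc M)) y + ktot k m D (disk_sum k m M) y) 0"
    by (rule agree_at_0[OF ktot_pow_cong])
  also have "\<dots> = (ktot k m D ^^ j) (disk_start k (Suc (Suc M))) 0 + (ktot k m D ^^ Suc j) (disk_sum k m M) 0"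
    by (subst ktot_pow_add) (simp_all add: disk_start_meromorphic ktot_meromorphic disk_sum_meromorphic funpow_swap1)
  also have "\<dots> = (\<Sum>i\<le>Suc M. (ktot k m D ^^ (j + i)) (disk_start k (Suc (Suc M) - i)) 0)"
    using Suc.IH[of "Suc j"] Suc.prems by (subst sum.atMost_Suc_shift) simp
  finally show ?case .
qed

text \<open>At 0 only the constant term of \<open>S\<close> survives, and its factor
  \<open>half_odd M\<close> cancels the denominator.\<close>

lemma disk_sum_0: "disk_sum k m M 0 = fps_nth (F_coeffs k m) M"
proof -
  have "S_num k m (S_fun k) M 0 = (\<Sum>b\<in>{M}. half_odd b * fps_nth (F_coeffs k m) b * S_fun k m (M - b) 0)"
    unfolding S_num_def by (rule sum.mono_neutral_right) (auto simp: S_fun_def)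
  then show ?thesis using half_odd_neq(2)[of M 0] by (simp add: disk_sum_def S_fun_def)
qed

lemma w_disk_eq_F_coeffs:
  assumes k: "k = 2 * m + 1" "m > 0" and d: "d \<ge> 1"
  shows "w_disk k k (m - 1) d = fps_nth (F_coeffs k m) (d - 1)"
proof -
  have "w_disk k k (m - 1) d = (\<Sum>j=0..d-1. (ktot k m d ^^ j) (disk_start k (d - j)) 0)"
    by (rule w_disk_eq_ktot[OF k]) (use d in simp)
  also have "\<dots> = (ktot k m d ^^ 0) (disk_sum k m (d - 1)) 0"
    unfolding ktot_pow_disk_sum[OF k diff_le_self] using d by (simp add: atMost_atLeast0)
  finally show ?thesis by (simp add: disk_sum_0)
qed

text \<open>The first conjunct keeps the second from being vacuous. The value \<open>c 0\<close>
  does not occur in \<open>odd_exp_series c\<close>, hence \<open>d\<close> starts at 1.\<close>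

theorem theorem1:
  fixes k :: nat
  assumes "odd k" and "k \<ge> 3"
  shows "(\<exists>c. F_o k = odd_exp_series c) \<and>
         (\<forall>c. F_o k = odd_exp_series c \<longrightarrow> (\<forall>d\<ge>1. c d = w_disk k k ((k - 3) div 2) d))"
proof -
  obtain m where k: "k = 2 * m + 1" using \<open>odd k\<close> by (elim oddE)
  have m: "m > 0" using \<open>k \<ge> 3\<close> k by simp
  have a: "(k - 3) div 2 = m - 1" using k by simp
  have F: "F_o k = odd_exp_series (\<lambda>d. fps_nth (F_coeffs k m) (d - 1))"
    using F_o_eq[OF k m] by (simp add: odd_series_def)
  have "c d = w_disk k k ((k - 3) div 2) d" if "F_o k = odd_exp_series c" "d \<ge> 1" for c d
  proof -
    have "c d = fps_nth (F_coeffs k m) (d - 1)"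
      using odd_exp_series_inj[of c "\<lambda>d. fps_nth (F_coeffs k m) (d - 1)" d] that F by simp
    then show ?thesis using w_disk_eq_F_coeffs[OF k m \<open>d \<ge> 1\<close>] a by simp
  qed
  then show ?thesis using F by blast
qed

end
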